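(* Let $H$ be an infinite-dimensional separable complex Hilbert space and let $A \in C([0,1], L(H))$ be such that $0\in \operatorname{Int} W_e(A(t))$ for all $t\in [0,1]$. Let $Z$ be a separable Hilbert space, and let $D \in C([0,1], L(Z))$ satisfy \[ \max_{t\in [0,1]}\|D(t)\|<\min_{t\in [0,1]}\operatorname{dist} \bigl(0,\partial W_e(A(t))\bigr). \] Then there exists $S \in C([0,1], L(Z,H))$ such that $S(t)$ is an isometry for every $t\in[0,1]$ and \[ S^*(t)A(t)S(t)=D(t), \qquad t\in [0,1]. \]
   Context: All Hilbert spaces are complex and separable; subspaces are closed. $L(K,H)$ denotes the bounded linear operators from $K$ to $H$, $L(H)=L(H,H)$, and $C([0,1],X)$ denotes the norm-continuous functions $[0,1]\to X$ for a Banach space $X$. For $T\in L(H)$ the essential numerical range $W_e(T)$ is the set of all $\lambda\in\mathbb C$ for which there is an orthonormal sequence $(u_n)$ in $H$ with $\langle Tu_n,u_n\rangle\to\lambda$; it is a nonempty compact convex subset of $\mathbb C$. $\operatorname{Int}$ and $\partial$ denote the interior and the boundary in $\mathbb C$. *)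

theory Defs
  imports "HOL-Analysis.Analysis"
begin

class complex_inner = real_normed_vector +
  fixes scaleC :: "complex \<Rightarrow> 'a \<Rightarrow> 'a"
    and cinner :: "'a \<Rightarrow> 'a \<Rightarrow> complex"
  assumes scaleC_of_real: "scaleC (of_real r) x = scaleR r x"
    and scaleC_add_right: "scaleC a (x + y) = scaleC a x + scaleC a y"
    and scaleC_add_left: "scaleC (a + b) x = scaleC a x + scaleC b x"
    and scaleC_scaleC: "scaleC a (scaleC b x) = scaleC (a * b) x"
    and cinner_commute: "cinner x y = cnj (cinner y x)"
    and cinner_add_left: "cinner (x + y) z = cinner x z + cinner y z"
    and cinner_scaleC_left: "cinner (scaleC a x) y = a * cinner x y"
    and cinner_self: "cinner x x = complex_of_real ((norm x)\<^sup>2)"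

text \<open>A bounded (real-)linear map between complex inner product spaces is a
bounded operator in the complex sense iff it is also complex-homogeneous.\<close>

definition is_cbounded_op :: "('a::complex_inner \<Rightarrow>\<^sub>L 'b::complex_inner) \<Rightarrow> bool" where
  "is_cbounded_op T \<longleftrightarrow> (\<forall>c x. blinfun_apply T (scaleC c x) = scaleC c (blinfun_apply T x))"

definition orthonormal_seq :: "(nat \<Rightarrow> 'a::complex_inner) \<Rightarrow> bool" where
  "orthonormal_seq u \<longleftrightarrow> (\<forall>m n. cinner (u m) (u n) = (if m = n then 1 else 0))"

definition ess_num_range :: "('a::complex_inner \<Rightarrow>\<^sub>L 'a) \<Rightarrow> complex set" where
  "ess_num_range T = {l. \<exists>u. orthonormal_seq u \<and>
      (\<lambda>n. cinner (blinfun_apply T (u n)) (u n)) \<longlonglongrightarrow> l}"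

text \<open>Infinite dimensionality (over the reals, equivalently over the complex numbers).\<close>

definition infinite_dimensional :: "'a::real_vector itself \<Rightarrow> bool" where
  "infinite_dimensional _ \<longleftrightarrow> \<not> (\<exists>B. finite B \<and> span B = (UNIV :: 'a set))"

end

theory Submission
  imports Defs
begin

text \<open>
A strict contraction \<open>T\<close> dilates to a cyclic shift: with \<open>R\<^sup>2 = 1 - T\<^sup>*T\<close> the operators
\<open>R, RT, \<dots>, RT\<^bsup>n-1\<^esup>, T\<^bsup>n\<^esup>\<close> form an isometric column which the shift compresses to \<open>T\<close> up to an error
of order \<open>\<parallel>T\<parallel>\<^bsup>n\<^esup>\<close>. Diagonalising the shift by the discrete Fourier transform gives operators
\<open>Y\<^sub>k\<close>, continuous in \<open>T\<close>, with \<open>\<Sum> Y\<^sub>k\<^sup>*Y\<^sub>k = 1\<close> and \<open>\<Sum> \<omega>\<^bsup>k\<^esup> Y\<^sub>k\<^sup>*Y\<^sub>k \<approx> T\<close>, where \<open>\<omega>\<close> is a root of unity.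

On the side of \<open>H\<close>, orthonormal sequences realising points of the essential numerical ranges at
finitely many times yield fixed isometries \<open>U\<^sub>y\<close> with mutually orthogonal ranges such that
\<open>U\<^sub>x\<^sup>*A(t)U\<^sub>y\<close> is tiny for \<open>x \<noteq> y\<close> and all \<open>t\<close>, while \<open>U\<^sub>y\<^sup>*A(\<tau>\<^sub>y)U\<^sub>y \<approx> \<mu>\<^sub>y\<close> for prescribed \<open>\<tau>\<^sub>y\<close>
and \<open>\<mu>\<^sub>y\<close>. A partition of unity in \<open>t\<close> made of squares combines the two, so that every continuous
\<open>D\<close> within the norm bound is approximately a compression by a continuous family of isometries
\<open>\<Sum> U\<^sub>a B\<^sub>a(t)\<close>.

Exactness comes from a geometric series \<open>S = \<Sum> c\<^sub>l S\<^sub>l\<close> with \<open>\<Sum> c\<^sub>l\<^sup>2 = 1\<close> of such isometries with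
orthogonal ranges: the target of \<open>S\<^sub>l\<close> is \<open>D\<close> plus \<open>c\<^sub>l\<^bsup>-2\<^esup>\<close> times the error accumulated by the
previous terms, so the errors telescope. The gap between the two sides of the norm hypothesis
leaves room for these corrected targets.
\<close>


subsection \<open>Complex inner product spaces\<close>

lemma cinner_add_right: "cinner x (y + z) = cinner x y + cinner x z"
  by (metis cinner_add_left cinner_commute complex_cnj_add)

lemma cinner_scaleC_right: "cinner x (scaleC a y) = cnj a * cinner x y"
  by (metis cinner_commute cinner_scaleC_left complex_cnj_mult)

lemma cinner_scaleR_left: "cinner (r *\<^sub>R x) y = r *\<^sub>R cinner x y"
  by (metis cinner_scaleC_left scaleC_of_real scaleR_conv_of_real)

lemma cinner_scaleR_right: "cinner x (r *\<^sub>R y) = r *\<^sub>R cinner x y"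
  by (metis cinner_scaleC_right scaleC_of_real scaleR_conv_of_real complex_cnj_complex_of_real)

lemma norm_scaleC: "norm (scaleC a x) = cmod a * norm (x::'a::complex_inner)"
proof -
  have "complex_of_real ((norm (scaleC a x))\<^sup>2) = a * cnj a * complex_of_real ((norm x)\<^sup>2)"
    by (metis cinner_self cinner_scaleC_left cinner_scaleC_right mult.assoc)
  also have "\<dots> = complex_of_real ((cmod a * norm x)\<^sup>2)"
    by (simp add: power_mult_distrib flip: complex_norm_square)
  finally show ?thesis
    by (metis of_real_eq_iff norm_ge_zero mult_nonneg_nonneg power2_eq_imp_eq)
qed

lemma scaleC_zero_left [simp]: "scaleC 0 (x::'a::complex_inner) = 0"
  using norm_scaleC[of 0 x] by simp

lemma scaleC_zero_right [simp]: "scaleC a (0::'a::complex_inner) = 0"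
  using norm_scaleC[of a 0] by simp

lemma scaleC_one [simp]: "scaleC 1 (x::'a::complex_inner) = x"
  using scaleC_of_real[of 1 x] by simp

lemma scaleC_scaleR: "scaleC a (r *\<^sub>R x) = r *\<^sub>R scaleC a (x::'a::complex_inner)"
  by (metis mult.commute scaleC_of_real scaleC_scaleC)

lemma bounded_linear_scaleC: "bounded_linear (scaleC a :: 'a::complex_inner \<Rightarrow> 'a)"
  by (rule bounded_linear_intro[where K = "cmod a"])
    (simp_all add: scaleC_add_right scaleC_scaleR norm_scaleC mult.commute)

lemma bounded_linear_scaleC_left: "bounded_linear (\<lambda>a. scaleC a (x :: 'a::complex_inner))"
proof (rule bounded_linear_intro[where K = "norm x"])
  show "scaleC (r *\<^sub>R a) x = r *\<^sub>R scaleC a x" for r a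
    by (metis scaleC_of_real scaleC_scaleC scaleR_conv_of_real)
qed (simp_all add: scaleC_add_left norm_scaleC)

lemma scaleC_diff_right: "scaleC a (x - y) = scaleC a x - scaleC a (y::'a::complex_inner)"
  using bounded_linear.linear[OF bounded_linear_scaleC] linear_diff by blast

lemma scaleC_sum_right: "scaleC a (\<Sum>i\<in>I. f i) = (\<Sum>i\<in>I. scaleC a (f i :: 'a::complex_inner))"
  using bounded_linear.linear[OF bounded_linear_scaleC] linear_sum by blast

lemma cinner_zero_left [simp]: "cinner 0 x = 0"
  using cinner_add_left[of 0 0 x] by simp

lemma cinner_Cauchy_Schwarz: "cmod (cinner x y) \<le> norm x * norm (y::'a::complex_inner)"
proof (cases "y = 0")
  case True
  then show ?thesis using cinner_add_right[of x 0 0] by simp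
next
  case False
  define c where "c = cinner x y / of_real ((norm y)\<^sup>2)"
  define n where "n = (norm y)\<^sup>2"
  have n: "n > 0" using False by (simp add: n_def)
  have cn: "cinner x y = c * of_real n" using n by (simp add: c_def n_def)
  have cn': "cinner y x = cnj c * of_real n"
    by (subst cinner_commute) (simp add: cn)
  define d where "d = x + scaleC (- c) y"
  have "complex_of_real ((norm d)\<^sup>2) = cinner d d" by (simp add: cinner_self)
  also have "\<dots> = of_real ((norm x)\<^sup>2) - c * cnj c * of_real n"
    using cinner_self[of x] cinner_self[of y]
    by (simp add: d_def cinner_add_left cinner_add_right cinner_scaleC_left cinner_scaleC_right
        cn cn' algebra_simps flip: n_def)
  also have "\<dots> = of_real ((norm x)\<^sup>2 - (cmod c)\<^sup>2 * n)"
    by (simp flip: complex_norm_square)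
  finally have "(norm d)\<^sup>2 = (norm x)\<^sup>2 - (cmod c)\<^sup>2 * n"
    using of_real_eq_iff by blast
  then have "(cmod c)\<^sup>2 * n \<le> (norm x)\<^sup>2"
    by (metis diff_ge_0_iff_ge zero_le_power2)
  then have "(cmod c * norm y)\<^sup>2 \<le> (norm x)\<^sup>2"
    by (simp add: power_mult_distrib n_def)
  then have "cmod c * norm y \<le> norm x"
    by (rule power2_le_imp_le) simp
  moreover have "cmod (cinner x y) = cmod c * norm y * norm y"
    using cn n by (simp add: norm_mult n_def power2_eq_square)
  ultimately show ?thesis
    by (simp add: mult_right_mono)
qed

lemma bounded_bilinear_cinner: "bounded_bilinear (cinner :: 'a::complex_inner \<Rightarrow> _)"
proof
  show "\<exists>K. \<forall>a b :: 'a. cmod (cinner a b) \<le> norm a * norm b * K"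
    by (intro exI[of _ 1]) (simp add: cinner_Cauchy_Schwarz)
qed (simp_all add: cinner_add_left cinner_add_right cinner_scaleR_left cinner_scaleR_right)

lemmas cinner_diff_left = bounded_bilinear.diff_left[OF bounded_bilinear_cinner]
lemmas cinner_diff_right = bounded_bilinear.diff_right[OF bounded_bilinear_cinner]
lemmas cinner_zero_right [simp] = bounded_bilinear.zero_right[OF bounded_bilinear_cinner]
lemmas cinner_sum_left = bounded_bilinear.sum_left[OF bounded_bilinear_cinner]
lemmas cinner_sum_right = bounded_bilinear.sum_right[OF bounded_bilinear_cinner]
lemmas tendsto_cinner = bounded_bilinear.tendsto[OF bounded_bilinear_cinner]
lemmas tendsto_scaleC_right = bounded_linear.tendsto[OF bounded_linear_scaleC]

lemma cinner_eqI:
  assumes "\<And>w. cinner x w = cinner y w" shows "x = (y::'a::complex_inner)"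
proof -
  have "cinner (x - y) (x - y) = 0" using assms by (simp add: cinner_diff_left)
  then show ?thesis by (simp add: cinner_self)
qed

lemma norm_eq_of_cinner:
  assumes "cinner (x::'a::complex_inner) x = cinner (y::'b::complex_inner) y"
  shows "norm x = norm y"
proof -
  have "complex_of_real ((norm x)\<^sup>2) = of_real ((norm y)\<^sup>2)"
    using assms by (simp only: cinner_self)
  then have "(norm x)\<^sup>2 = (norm y)\<^sup>2" using of_real_eq_iff by blast
  then show ?thesis by simp
qed

lemma norm_le_of_cinner:
  assumes "K \<ge> 0" "\<And>w. cmod (cinner x w) \<le> K * norm w"
  shows "norm (x::'a::complex_inner) \<le> K"
proof (cases "x = 0")
  case False
  have "cmod (cinner x x) = norm x * norm x"
    by (simp add: cinner_self norm_power power2_eq_square norm_mult)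
  then have "norm x * norm x \<le> K * norm x"
    using assms(2)[of x] by simp
  then show ?thesis using False by simp
qed (use assms in simp)

lemma norm_blinfun_le_of_cinner:
  fixes T :: "'a::real_normed_vector \<Rightarrow>\<^sub>L 'b::complex_inner"
  assumes "K \<ge> 0" "\<And>z w. cmod (cinner (T z) w) \<le> K * norm z * norm w"
  shows "norm T \<le> K"
  using assms(1) by (intro norm_blinfun_bound norm_le_of_cinner)
    (simp_all add: assms(2))

subsection \<open>Orthogonal sequences\<close>

text \<open>Bounding the norms by 1 instead of fixing them admits zero vectors. Finite-dimensional
  spaces then have bases indexed by all of \<open>nat\<close> as well.\<close>

definition orthogonal_seq :: "(nat \<Rightarrow> 'a::complex_inner) \<Rightarrow> bool" where
  "orthogonal_seq e \<longleftrightarrow> (\<forall>i j. i \<noteq> j \<longrightarrow> cinner (e i) (e j) = 0) \<and> (\<forall>i. norm (e i) \<le> 1)"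

lemma norm_orthonormal_seq: "orthonormal_seq u \<Longrightarrow> norm (u n) = 1"
proof -
  assume "orthonormal_seq u"
  then have "complex_of_real ((norm (u n))\<^sup>2) = 1"
    by (metis cinner_self orthonormal_seq_def)
  then have "(norm (u n))\<^sup>2 = 1" using of_real_eq_1_iff by blast
  then show ?thesis by (metis norm_ge_zero power2_eq_1_iff zero_le_one neg_0_le_iff_le not_one_le_zero)
qed

lemma orthonormal_imp_orthogonal_seq: "orthonormal_seq u \<Longrightarrow> orthogonal_seq u"
  by (simp add: orthogonal_seq_def norm_orthonormal_seq) (simp add: orthonormal_seq_def)

lemma norm_sum_orthogonal:
  assumes e: "orthogonal_seq e" and "finite F"
  shows "(norm (\<Sum>i\<in>F. scaleC (a i) (e i)))\<^sup>2 = (\<Sum>i\<in>F. (cmod (a i))\<^sup>2 * (norm (e i))\<^sup>2)"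
proof -
  have "complex_of_real ((norm (\<Sum>i\<in>F. scaleC (a i) (e i)))\<^sup>2)
      = (\<Sum>i\<in>F. \<Sum>j\<in>F. a j * (cnj (a i) * cinner (e j) (e i)))"
    by (subst cinner_self[symmetric])
      (simp add: cinner_sum_left cinner_sum_right cinner_scaleC_left cinner_scaleC_right
        sum_distrib_left mult.left_commute)
  also have "\<dots> = (\<Sum>i\<in>F. \<Sum>j\<in>F. if j = i then of_real ((cmod (a i))\<^sup>2 * (norm (e i))\<^sup>2) else 0)"
    using e by (intro sum.cong refl)
      (auto simp: orthogonal_seq_def cinner_self simp flip: complex_norm_square)
  also have "\<dots> = of_real (\<Sum>i\<in>F. (cmod (a i))\<^sup>2 * (norm (e i))\<^sup>2)"
    using \<open>finite F\<close> by simp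
  finally show ?thesis using of_real_eq_iff by blast
qed

lemma norm_sum_orthogonal_le:
  assumes e: "orthogonal_seq e" and "finite F"
  shows "(norm (\<Sum>i\<in>F. scaleC (a i) (e i)))\<^sup>2 \<le> (\<Sum>i\<in>F. (cmod (a i))\<^sup>2)"
proof -
  have "(norm (e i))\<^sup>2 \<le> 1" for i
    using e by (simp add: orthogonal_seq_def power_le_one)
  then show ?thesis unfolding norm_sum_orthogonal[OF assms]
    by (intro sum_mono) (simp add: mult_left_le)
qed

text \<open>Pythagoras bounds the norm of a block of the vector series by a block of the numerical
  series, so the Cauchy property carries over.\<close>

lemma convergent_orthogonal_series:
  fixes e :: "nat \<Rightarrow> 'a::{complex_inner,complete_space}"
  assumes e: "orthogonal_seq e" and C: "\<And>N. (\<Sum>i<N. (cmod (a i))\<^sup>2) \<le> C"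
  shows "convergent (\<lambda>N. \<Sum>i<N. scaleC (a i) (e i))"
proof -
  have sm: "summable (\<lambda>i. (cmod (a i))\<^sup>2)"
    by (rule summableI_nonneg_bounded[OF _ C]) simp
  have "Cauchy (\<lambda>N. \<Sum>i<N. scaleC (a i) (e i))"
  proof (rule metric_CauchyI)
    fix \<epsilon> :: real assume "\<epsilon> > 0"
    then obtain N0 where N0: "\<And>m n. m \<ge> N0 \<Longrightarrow> norm (\<Sum>i=m..<n. (cmod (a i))\<^sup>2) < \<epsilon>\<^sup>2"
      using sm unfolding summable_Cauchy by (meson zero_less_power)
    have *: "dist (\<Sum>i<m. scaleC (a i) (e i)) (\<Sum>i<n. scaleC (a i) (e i)) < \<epsilon>"
      if "N0 \<le> m" "m \<le> n" for m n
    proof -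
      have "{..<n} = {..<m} \<union> {m..<n}" using that by auto
      then have "(\<Sum>i<n. scaleC (a i) (e i)) - (\<Sum>i<m. scaleC (a i) (e i)) = (\<Sum>i=m..<n. scaleC (a i) (e i))"
        by (simp add: sum.union_disjoint ivl_disj_int)
      moreover have "(norm (\<Sum>i=m..<n. scaleC (a i) (e i)))\<^sup>2 < \<epsilon>\<^sup>2"
        using norm_sum_orthogonal_le[OF e, of "{m..<n}" a] N0[OF that(1), of n] by simp
      then have "norm (\<Sum>i=m..<n. scaleC (a i) (e i)) < \<epsilon>"
        using \<open>\<epsilon> > 0\<close> power2_less_imp_less by fastforce
      ultimately show ?thesis by (metis dist_commute dist_norm)
    qed
    show "\<exists>M. \<forall>m\<ge>M. \<forall>n\<ge>M. dist (\<Sum>i<m. scaleC (a i) (e i)) (\<Sum>i<n. scaleC (a i) (e i)) < \<epsilon>"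
      by (intro exI[of _ N0]) (metis * dist_commute nle_le)
  qed
  then show ?thesis by (simp add: Cauchy_convergent_iff)
qed

text \<open>Testing \<open>f\<close> on the sum of the vectors
  \<open>scaleC (cnj (f (e i))) (e i)\<close> gives s^2 <= K^2 s for the partial sum s of the
  squares. A general functional is taken because both the Riesz representation and the weak
  convergence of orthogonal sequences rest on this bound.\<close>

lemma Bessel_functional:
  fixes f :: "'a::complex_inner \<Rightarrow> complex"
  assumes e: "orthogonal_seq e"
    and add: "\<And>x y. f (x + y) = f x + f y" and scale: "\<And>c x. f (scaleC c x) = c * f x"
    and K: "\<And>x. cmod (f x) \<le> K * norm x"
  shows "(\<Sum>i<N. (cmod (f (e i)))\<^sup>2) \<le> K\<^sup>2"
proof -
  define s where "s = (\<Sum>i<N. (cmod (f (e i)))\<^sup>2)"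
  define x where "x = (\<Sum>i<N. scaleC (cnj (f (e i))) (e i))"
  have s0: "s \<ge> 0" by (simp add: s_def sum_nonneg)
  have f0: "f 0 = 0" using scale[of 0 0] by simp
  have "f x = (\<Sum>i<N. cnj (f (e i)) * f (e i))"
    unfolding x_def by (induction N) (simp_all add: f0 add scale)
  also have "\<dots> = complex_of_real s"
    unfolding s_def of_real_sum by (simp only: complex_norm_square mult.commute)
  finally have "s \<le> K * norm x" using K[of x] s0 by simp
  then have "s\<^sup>2 \<le> (K * norm x)\<^sup>2" using s0 by (simp add: power_mono)
  also have "\<dots> \<le> K\<^sup>2 * s"
    using norm_sum_orthogonal_le[OF e, of "{..<N}" "\<lambda>i. cnj (f (e i))"]
    by (simp add: power_mult_distrib s_def x_def mult_left_mono)
  finally have "s * s \<le> K\<^sup>2 * s" by (simp add: power2_eq_square)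
  then have "s \<le> K\<^sup>2" using s0 by (cases "s = 0") auto
  then show ?thesis by (simp add: s_def)
qed

text \<open>Values with summable squares tend to zero. This is the weak convergence to zero of
  orthogonal sequences, which later makes old vectors almost invisible to the tail of a new
  sequence.\<close>

lemma tendsto_functional_orthogonal_seq:
  fixes f :: "'a::complex_inner \<Rightarrow> complex"
  assumes "orthogonal_seq e"
    and "\<And>x y. f (x + y) = f x + f y" and "\<And>c x. f (scaleC c x) = c * f x"
    and "\<And>x. cmod (f x) \<le> K * norm x"
  shows "(\<lambda>i. f (e i)) \<longlonglongrightarrow> 0"
proof -
  have "summable (\<lambda>i. (cmod (f (e i)))\<^sup>2)"
    by (rule summableI_nonneg_bounded[OF _ Bessel_functional[OF assms]]) simp
  then have "(\<lambda>i. (cmod (f (e i)))\<^sup>2) \<longlonglongrightarrow> 0" by (rule summable_LIMSEQ_zero)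
  then have "(\<lambda>i. sqrt ((cmod (f (e i)))\<^sup>2)) \<longlonglongrightarrow> sqrt 0" by (rule tendsto_real_sqrt)
  then show ?thesis by (simp add: tendsto_norm_zero_iff)
qed

lemma Bessel:
  assumes e: "orthogonal_seq e" shows "(\<Sum>i<N. (cmod (cinner x (e i)))\<^sup>2) \<le> (norm x)\<^sup>2"
proof -
  have "cmod (cinner x (e i)) = cmod (cinner (e i) x)" for i
    by (metis cinner_commute complex_mod_cnj)
  moreover have "(\<Sum>i<N. (cmod (cinner (e i) x))\<^sup>2) \<le> (norm x)\<^sup>2"
    by (rule Bessel_functional[OF e])
      (simp_all add: cinner_add_left cinner_scaleC_left mult.commute[of "norm x"] cinner_Cauchy_Schwarz)
  ultimately show ?thesis by simp
qed

section \<open>Expansions and orthogonal bases\<close>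

lemma convergent_orthonormal_expansion:
  fixes v :: "nat \<Rightarrow> 'b::{complex_inner,complete_space}"
  assumes "orthogonal_seq e" "orthogonal_seq v"
  shows "convergent (\<lambda>N. \<Sum>i<N. scaleC (cinner x (e i)) (v i))"
  using convergent_orthogonal_series[OF assms(2) Bessel[OF assms(1)]] .

text \<open>The expansion carries no normalising factor. Applied to \<open>x = e j\<close> it shows
  that \<open>e j\<close> is its squared norm times itself, so each \<open>e j\<close> is zero or a
  unit vector.\<close>

definition orthogonal_basis :: "(nat \<Rightarrow> 'a::complex_inner) \<Rightarrow> bool" where
  "orthogonal_basis e \<longleftrightarrow> orthogonal_seq e \<and>
    (\<forall>x. (\<lambda>N. \<Sum>i<N. scaleC (cinner x (e i)) (e i)) \<longlonglongrightarrow> x)"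

lemma cinner_commute_zero: "cinner x y = 0 \<Longrightarrow> cinner y x = 0"
  by (metis cinner_commute complex_cnj_zero)

lemma cinner_expansion_residual:
  fixes e :: "nat \<Rightarrow> 'a::complex_inner"
  assumes e: "orthogonal_seq e" "\<forall>i. e i = 0 \<or> norm (e i) = 1" and "j < N"
  shows "cinner (x - (\<Sum>i<N. scaleC (cinner x (e i)) (e i))) (e j) = 0"
proof -
  have "cinner (\<Sum>i<N. scaleC (cinner x (e i)) (e i)) (e j)
      = (\<Sum>i<N. if i = j then cinner x (e j) * cinner (e j) (e j) else 0)"
    unfolding cinner_sum_left cinner_scaleC_left
    using e(1) by (intro sum.cong refl) (auto simp: orthogonal_seq_def)
  also have "\<dots> = cinner x (e j) * cinner (e j) (e j)" using \<open>j < N\<close> by (subst sum.delta) auto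
  also have "\<dots> = cinner x (e j)"
    using e(2)[rule_format, of j] by (auto simp: cinner_self)
  finally show ?thesis by (simp add: cinner_diff_left)
qed

text \<open>The residual of the expansion is orthogonal to every combination of the first
  \<open>N\<close> vectors, so by Pythagoras other coefficients only add to the distance.\<close>

lemma expansion_best_approximation:
  fixes e :: "nat \<Rightarrow> 'a::complex_inner"
  assumes e: "orthogonal_seq e" "\<forall>i. e i = 0 \<or> norm (e i) = 1"
  shows "norm (x - (\<Sum>i<N. scaleC (cinner x (e i)) (e i))) \<le> norm (x - (\<Sum>i<N. scaleC (c i) (e i)))"
proof -
  define p where "p = x - (\<Sum>i<N. scaleC (cinner x (e i)) (e i))"
  define d where "d = (\<Sum>i<N. scaleC (cinner x (e i) - c i) (e i))"
  have pd: "cinner p d = 0"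
    unfolding d_def cinner_sum_right cinner_scaleC_right p_def
    by (intro sum.neutral ballI) (simp add: cinner_expansion_residual[OF e])
  have "cinner d p = 0" using pd by (metis cinner_commute complex_cnj_zero)
  then have "complex_of_real ((norm (p + d))\<^sup>2) = of_real ((norm p)\<^sup>2 + (norm d)\<^sup>2)"
    using pd unfolding of_real_add cinner_self[symmetric]
    by (simp add: cinner_add_left cinner_add_right)
  then have "(norm (p + d))\<^sup>2 = (norm p)\<^sup>2 + (norm d)\<^sup>2" using of_real_eq_iff by blast
  then have "(norm p)\<^sup>2 \<le> (norm (p + d))\<^sup>2" by simp
  moreover have "p + d = x - (\<Sum>i<N. scaleC (c i) (e i))"
  proof -
    have "scaleC (a - b) y = scaleC a y - scaleC b (y::'a)" for a b y
      using bounded_linear.linear[OF bounded_linear_scaleC_left] linear_diff by blast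
    then show ?thesis by (simp add: p_def d_def sum_subtractf)
  qed
  ultimately show ?thesis unfolding p_def by (metis norm_ge_zero power2_le_imp_le)
qed

text \<open>Normalising the zero vector gives zero again, so Gram-Schmidt applied to a dense sequence
needs no linear independence; the basis just contains zero vectors.\<close>

lemma separable_imp_orthogonal_basis:
  assumes "separable_space (euclidean :: 'a::complex_inner topology)"
  shows "\<exists>e :: nat \<Rightarrow> 'a. orthogonal_basis e"
proof -
  obtain C :: "'a set" where C: "countable C" "closure C = UNIV"
    using assms unfolding separable_space_def by auto
  then have "C \<noteq> {}" by auto
  then obtain d :: "nat \<Rightarrow> 'a" where d: "range d = C"
    using C(1) uncountable_def by metis
  \<comment> \<open>The last conjunct keeps \<open>d n\<close> in the span of the first n + 1 chosen
    vectors; through it the density of the sequence \<open>d\<close> later forces the expansions to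
    converge.\<close>
  define P where "P f n r \<longleftrightarrow> (\<forall>i<n. cinner r (f i) = 0) \<and> (r = 0 \<or> norm r = 1) \<and>
      (\<exists>c. d n = (\<Sum>i<n. scaleC (c i) (f i)) + scaleC (c n) r)" for f :: "nat \<Rightarrow> 'a" and n r
  have "\<exists>f. \<forall>n. P f n (f n)"
  proof (rule dependent_wellorder_choice)
    show "P f x r = P g x r" if "\<And>y. y < x \<Longrightarrow> f y = g y" for r f g x
      using that by (simp add: P_def)
  next
    fix n and f :: "nat \<Rightarrow> 'a"
    assume IH: "\<And>y. y < n \<Longrightarrow> P f y (f y)"
    have nf: "norm (f i) \<le> 1" if "i < n" for i
      using IH[OF that] by (auto simp: P_def)
    \<comment> \<open>Continuing by zero turns the finitely many vectors chosen so far into an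
      \<open>orthogonal_seq\<close>, to which \<open>cinner_expansion_residual\<close>
      applies.\<close>
    define f' where "f' i = (if i < n then f i else 0)" for i
    have sym: "cinner (f i) (f j) = 0" if "i < n" "j < n" "i \<noteq> j" for i j
      using IH[OF that(1)] IH[OF that(2)] that
      by (cases "i < j") (auto simp: P_def intro: cinner_commute_zero)
    define w where "w = d n - (\<Sum>i<n. scaleC (cinner (d n) (f' i)) (f' i))"
    have w: "cinner w (f i) = 0" if "i < n" for i
    proof -
      have "cinner w (f' i) = 0" unfolding w_def
        using sym IH by (intro cinner_expansion_residual that) (auto simp: orthogonal_seq_def f'_def P_def nf)
      then show ?thesis using that by (simp add: f'_def)
    qed
    define c where "c i = (if i < n then cinner (d n) (f i) else of_real (norm w))" for i
    have "d n = (\<Sum>i<n. scaleC (cinner (d n) (f' i)) (f' i)) + w" by (simp add: w_def)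
    also have "(\<Sum>i<n. scaleC (cinner (d n) (f' i)) (f' i)) = (\<Sum>i<n. scaleC (c i) (f i))"
      by (intro sum.cong) (auto simp: f'_def c_def)
    also have "w = scaleC (c n) (w /\<^sub>R norm w)"
      by (cases "w = 0") (simp_all add: c_def scaleC_of_real)
    finally have "d n = (\<Sum>i<n. scaleC (c i) (f i)) + scaleC (c n) (w /\<^sub>R norm w)" .
    moreover have "w /\<^sub>R norm w = 0 \<or> norm (w /\<^sub>R norm w) = 1"
      by (cases "w = 0") auto
    ultimately have "P f n (w /\<^sub>R norm w)"
      unfolding P_def using w by (auto simp: cinner_scaleR_left)
    then show "\<exists>r. P f n r" ..
  qed
  then obtain e where e: "\<And>n. P e n (e n)" by auto
  have norm: "\<forall>i. e i = 0 \<or> norm (e i) = 1" using e by (simp add: P_def)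
  have "cinner (e i) (e j) = 0" if "i \<noteq> j" for i j
    using e[of i] e[of j] that
    by (cases "i < j") (auto simp: P_def intro: cinner_commute_zero)
  then have orth: "orthogonal_seq e"
    unfolding orthogonal_seq_def using norm by (metis norm_zero order_refl zero_le_one)
  have span: "\<exists>c. d n = (\<Sum>i<N. scaleC (c i) (e i))" if "n < N" for n N
  proof -
    obtain c where c: "d n = (\<Sum>i<n. scaleC (c i) (e i)) + scaleC (c n) (e n)"
      using e[of n] unfolding P_def by blast
    have "(\<Sum>i<N. scaleC (if i \<le> n then c i else 0) (e i)) = (\<Sum>i<Suc n. scaleC (c i) (e i))"
      using that by (intro sum.mono_neutral_cong_right) auto
    then show ?thesis using c by (intro exI[of _ "\<lambda>i. if i \<le> n then c i else 0"]) simp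
  qed
  have "(\<lambda>N. \<Sum>i<N. scaleC (cinner x (e i)) (e i)) \<longlonglongrightarrow> x" for x
  proof (rule metric_LIMSEQ_I)
    fix \<epsilon> :: real assume "\<epsilon> > 0"
    then obtain n where n: "dist (d n) x < \<epsilon>"
      using C(2) d closure_approachable[of x C] by (metis UNIV_I rangeE)
    \<comment> \<open>For every \<open>N > n\<close> the vector \<open>d n\<close> competes in the
      best approximation, so a single close \<open>d n\<close> controls all later partial
      sums.\<close>
    have "dist (\<Sum>i<N. scaleC (cinner x (e i)) (e i)) x < \<epsilon>" if N: "N \<ge> Suc n" for N
    proof -
      obtain c where c: "d n = (\<Sum>i<N. scaleC (c i) (e i))"
        using span[of n N] N by auto
      show ?thesis
        using expansion_best_approximation[OF orth norm, where x = x and N = N and c = c] n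
        unfolding c[symmetric] by (simp add: dist_norm norm_minus_commute)
    qed
    then show "\<exists>N0. \<forall>N\<ge>N0. dist (\<Sum>i<N. scaleC (cinner x (e i)) (e i)) x < \<epsilon>" by blast
  qed
  then show ?thesis using orth unfolding orthogonal_basis_def by blast
qed

subsection \<open>Adjoints\<close>

lemma continuous_on_dist_le:
  fixes f :: "'a::metric_space \<Rightarrow> 'b::metric_space" and g :: "'a \<Rightarrow> 'c::metric_space"
  assumes g: "continuous_on I g"
    and le: "\<And>s t. s \<in> I \<Longrightarrow> t \<in> I \<Longrightarrow> dist (f s) (f t) \<le> C * dist (g s) (g t)"
  shows "continuous_on I f"
  unfolding continuous_on_iff
proof (intro ballI allI impI)
  fix t and \<epsilon> :: real assume t: "t \<in> I" and \<epsilon>: "\<epsilon> > 0"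
  define C' where "C' = max C 1"
  have C': "C' > 0" "C \<le> C'" by (auto simp: C'_def)
  then have "\<epsilon> / C' > 0" using \<epsilon> by simp
  then obtain \<delta> where \<delta>: "\<delta> > 0" "\<forall>s\<in>I. dist s t < \<delta> \<longrightarrow> dist (g s) (g t) < \<epsilon> / C'"
    using g t unfolding continuous_on_iff by blast
  have "dist (f s) (f t) < \<epsilon>" if "s \<in> I" "dist s t < \<delta>" for s
  proof -
    have "dist (f s) (f t) \<le> C' * dist (g s) (g t)"
      using le[OF that(1) t] mult_right_mono[OF C'(2) zero_le_dist[of "g s" "g t"]] by linarith
    also have "\<dots> < \<epsilon>" using \<delta> that C' by (simp add: pos_less_divide_eq mult.commute)
    finally show ?thesis .
  qed
  then show "\<exists>\<delta>>0. \<forall>s\<in>I. dist s t < \<delta> \<longrightarrow> dist (f s) (f t) < \<epsilon>" using \<delta>(1) by blast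
qed

lemma is_cbounded_op_scaleC: "is_cbounded_op T \<Longrightarrow> T (scaleC c x) = scaleC c (T x)"
  by (simp add: is_cbounded_op_def)

text \<open>The representing vector is the series with coefficients \<open>cnj (f (e i))\<close>,
  convergent by \<open>Bessel_functional\<close>. Both sides are limits of the same sums over the
  partial expansions of \<open>x\<close>.\<close>

lemma Riesz_orthogonal_basis:
  fixes e :: "nat \<Rightarrow> 'a::{complex_inner,complete_space}"
    and f :: "'a \<Rightarrow> complex"
  assumes e: "orthogonal_basis e"
    and add: "\<And>x y. f (x + y) = f x + f y" and scale: "\<And>c x. f (scaleC c x) = c * f x"
    and K: "\<And>x. cmod (f x) \<le> K * norm x"
  shows "\<exists>y. \<forall>x. f x = cinner x y"
proof -
  have eo: "orthogonal_seq e" and ex: "\<And>x. (\<lambda>N. \<Sum>i<N. scaleC (cinner x (e i)) (e i)) \<longlonglongrightarrow> x"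
    using e by (auto simp: orthogonal_basis_def)
  have "convergent (\<lambda>N. \<Sum>i<N. scaleC (cnj (f (e i))) (e i))"
    using Bessel_functional[OF eo add scale K]
    by (intro convergent_orthogonal_series[OF eo]) simp
  then obtain y where y: "(\<lambda>N. \<Sum>i<N. scaleC (cnj (f (e i))) (e i)) \<longlonglongrightarrow> y"
    unfolding convergent_def by blast
  have f0: "f 0 = 0" using scale[of 0 0] by simp
  have fs: "f (\<Sum>i<N. g i) = (\<Sum>i<N. f (g i))" for g and N :: nat
    by (induction N) (simp_all add: f0 add)
  have "f x = cinner x y" for x
  proof (rule LIMSEQ_unique)
    have "bounded_linear f"
    proof (rule bounded_linear_intro[OF add])
      show "f (r *\<^sub>R x) = r *\<^sub>R f x" for r x
        by (metis scale scaleC_of_real scaleR_conv_of_real)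
    qed (use K in \<open>simp add: mult.commute\<close>)
    then show "(\<lambda>N. f (\<Sum>i<N. scaleC (cinner x (e i)) (e i))) \<longlonglongrightarrow> f x"
      using ex bounded_linear.tendsto by blast
    have "f (\<Sum>i<N. scaleC (cinner x (e i)) (e i)) = cinner x (\<Sum>i<N. scaleC (cnj (f (e i))) (e i))" for N
      by (simp add: fs scale cinner_sum_right cinner_scaleC_right mult.commute)
    then show "(\<lambda>N. f (\<Sum>i<N. scaleC (cinner x (e i)) (e i))) \<longlonglongrightarrow> cinner x y"
      using tendsto_cinner[OF tendsto_const y] by simp
  qed
  then show ?thesis by blast
qed

text \<open>The choice is meaningful for complex-homogeneous operators whose domain is separable and
  complete, by \<open>adj_exists\<close>; the codomain can be any complex inner product
  space.\<close>

definition adj :: "('a::complex_inner \<Rightarrow>\<^sub>L 'b::complex_inner) \<Rightarrow> ('b \<Rightarrow>\<^sub>L 'a)" where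
  "adj T = (SOME T'. is_cbounded_op T' \<and> (\<forall>x y. cinner (T x) y = cinner x (T' y)))"

lemma adj_exists:
  fixes T :: "'a::{complex_inner,complete_space} \<Rightarrow>\<^sub>L 'b::complex_inner"
  assumes "separable_space (euclidean :: 'a topology)" and T: "is_cbounded_op T"
  shows "\<exists>T'. is_cbounded_op T' \<and> (\<forall>x y. cinner (T x) y = cinner x (T' y))"
proof -
  obtain e :: "nat \<Rightarrow> 'a" where e: "orthogonal_basis e"
    using separable_imp_orthogonal_basis[OF assms(1)] by blast
  have bd: "cmod (cinner (T x) y) \<le> (norm T * norm y) * norm x" for x y
  proof -
    have "cmod (cinner (T x) y) \<le> norm (T x) * norm y" by (rule cinner_Cauchy_Schwarz)
    also have "\<dots> \<le> (norm T * norm x) * norm y" by (intro mult_right_mono norm_blinfun) simp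
    finally show ?thesis by (simp add: mult_ac)
  qed
  have "\<exists>z. \<forall>x. cinner (T x) y = cinner x z" for y
    by (rule Riesz_orthogonal_basis[OF e _ _ bd])
      (simp_all add: blinfun.add_right cinner_add_left is_cbounded_op_scaleC[OF T] cinner_scaleC_left)
  then obtain g where g: "\<And>x y. cinner (T x) y = cinner x (g y)" by metis
  have sw: "cinner (g y) x = cinner y (T x)" for x y
    by (metis g cinner_commute)
  have sc: "g (scaleC c y) = scaleC c (g y)" for c y
    by (rule cinner_eqI) (simp add: sw cinner_scaleC_left)
  have bl: "bounded_linear g"
  proof (rule bounded_linear_intro[where K = "norm T"])
    show "g (x + y) = g x + g y" for x y by (rule cinner_eqI) (simp add: sw cinner_add_left)
    show "g (r *\<^sub>R x) = r *\<^sub>R g x" for r x by (metis sc scaleC_of_real)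
    show "norm (g x) \<le> norm x * norm T" for x
    proof (rule norm_le_of_cinner)
      show "cmod (cinner (g x) w) \<le> norm x * norm T * norm w" for w
        using bd[of w x] by (metis g cinner_commute complex_mod_cnj mult.commute)
    qed simp
  qed
  show ?thesis
    by (intro exI[of _ "Blinfun g"])
      (simp add: bounded_linear_Blinfun_apply[OF bl] g sc is_cbounded_op_def)
qed

context
  assumes sep: "separable_space (euclidean :: 'a::{complex_inner,complete_space} topology)"
begin

lemma
  fixes T :: "'a \<Rightarrow>\<^sub>L 'b::complex_inner"
  assumes "is_cbounded_op T"
  shows is_cbounded_op_adj: "is_cbounded_op (adj T)"
    and cinner_adj_right: "cinner x (adj T y) = cinner (T x) y"
    and cinner_adj_left: "cinner (adj T y) x = cinner y (T x)"
proof -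
  have *: "is_cbounded_op (adj T) \<and> (\<forall>x y. cinner (T x) y = cinner x (adj T y))"
    unfolding adj_def using adj_exists[OF sep assms] by (rule someI_ex)
  then show "is_cbounded_op (adj T)" "cinner x (adj T y) = cinner (T x) y" by auto
  show "cinner (adj T y) x = cinner y (T x)" using * by (metis cinner_commute)
qed

text \<open>The form with a difference yields norm continuity of \<open>adj\<close> directly,
  without a separate proof that the chosen adjoints are additive.\<close>

lemma norm_adj_diff_le:
  fixes T T' :: "'a \<Rightarrow>\<^sub>L 'b::complex_inner"
  assumes "is_cbounded_op T" "is_cbounded_op T'"
  shows "norm (adj T - adj T') \<le> norm (T - T')"
proof (rule norm_blinfun_le_of_cinner)
  fix y x
  have "cinner ((adj T - adj T') y) x = cinner y ((T - T') x)"
    by (simp add: blinfun.diff_left cinner_diff_left cinner_diff_right cinner_adj_left assms)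
  also have "cmod \<dots> \<le> norm y * (norm (T - T') * norm x)"
    by (meson cinner_Cauchy_Schwarz mult_left_mono norm_blinfun norm_ge_zero order_trans)
  finally show "cmod (cinner ((adj T - adj T') y) x) \<le> norm (T - T') * norm y * norm x"
    by (simp add: mult_ac)
qed simp

lemma norm_adj_le:
  fixes T :: "'a \<Rightarrow>\<^sub>L 'b::complex_inner"
  assumes "is_cbounded_op T"
  shows "norm (adj T) \<le> norm T"
proof (rule norm_blinfun_le_of_cinner)
  fix y x
  have "cmod (cinner (adj T y) x) \<le> norm y * (norm T * norm x)"
    unfolding cinner_adj_left[OF assms]
    by (meson cinner_Cauchy_Schwarz mult_left_mono norm_blinfun norm_ge_zero order_trans)
  then show "cmod (cinner (adj T y) x) \<le> norm T * norm y * norm x"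
    by (simp add: mult_ac)
qed simp

lemma continuous_on_adj:
  fixes T :: "real \<Rightarrow> 'a \<Rightarrow>\<^sub>L 'b::complex_inner"
  assumes "continuous_on I T" "\<And>t. t \<in> I \<Longrightarrow> is_cbounded_op (T t)"
  shows "continuous_on I (\<lambda>t. adj (T t))"
proof (rule continuous_on_dist_le[OF assms(1), of _ 1])
  show "dist (adj (T s)) (adj (T t)) \<le> 1 * dist (T s) (T t)" if "s \<in> I" "t \<in> I" for s t
    using norm_adj_diff_le[OF assms(2)[OF that(1)] assms(2)[OF that(2)]] by (simp add: dist_norm)
qed

end

subsection \<open>Almost diagonal sequences\<close>

text \<open>An orthonormal sequence realising \<open>\<mu>\<close> converges weakly to zero. Far out
  it is almost orthogonal to the vectors \<open>v p\<close>, also after the finitely many operators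
  of \<open>\<T>\<close> act on either side. Removing the components along the \<open>v p\<close>
  and normalising perturbs the tail by a vanishing amount.\<close>

lemma exists_fresh_vector:
  fixes v :: "nat \<Rightarrow> 'h::complex_inner"
  assumes lam: "\<mu> \<in> ess_num_range T" and "finite \<T>"
    and cb: "\<And>A. A \<in> \<T> \<Longrightarrow> is_cbounded_op A" and "\<epsilon> > 0"
    and v: "\<And>i j. i < q \<Longrightarrow> j < q \<Longrightarrow> cinner (v i) (v j) = (if i = j then 1 else 0)"
  shows "\<exists>w. norm w = 1 \<and> (\<forall>p<q. cinner w (v p) = 0) \<and>
    (\<forall>A\<in>\<T>. \<forall>p<q. cmod (cinner (A w) (v p)) < \<epsilon> \<and> cmod (cinner (A (v p)) w) < \<epsilon>) \<and>
    cmod (cinner (T w) w - \<mu>) < \<epsilon>"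
proof -
  obtain u where u: "orthonormal_seq u" and uT: "(\<lambda>n. cinner (T (u n)) (u n)) \<longlonglongrightarrow> \<mu>"
    using lam by (auto simp: ess_num_range_def)
  have uo: "orthogonal_seq u" using u by (rule orthonormal_imp_orthogonal_seq)
  have null: "(\<lambda>n. cinner (A (u n)) y) \<longlonglongrightarrow> 0" if "is_cbounded_op A" for A :: "'h \<Rightarrow>\<^sub>L 'h" and y
  proof (rule tendsto_functional_orthogonal_seq[OF uo])
    show "cmod (cinner (A x) y) \<le> norm A * norm y * norm x" for x
    proof -
      have "cmod (cinner (A x) y) \<le> norm (A x) * norm y" by (rule cinner_Cauchy_Schwarz)
      also have "\<dots> \<le> (norm A * norm x) * norm y" by (intro mult_right_mono norm_blinfun) simp
      finally show ?thesis by (simp add: mult_ac)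
    qed
  qed (simp_all add: blinfun.add_right cinner_add_left is_cbounded_op_scaleC[OF that] cinner_scaleC_left)
  have null_right: "(\<lambda>n. cinner y (u n)) \<longlonglongrightarrow> 0" for y
  proof -
    have "is_cbounded_op (id_blinfun :: 'h \<Rightarrow>\<^sub>L 'h)" by (simp add: is_cbounded_op_def)
    from null[OF this] have "(\<lambda>n. cnj (cinner (u n) y)) \<longlonglongrightarrow> cnj 0" by (intro tendsto_cnj) simp
    then show ?thesis by (subst cinner_commute) simp
  qed
  define x where "x N = u N - (\<Sum>p<q. scaleC (cinner (u N) (v p)) (v p))" for N
  define w where "w N = x N /\<^sub>R norm (x N)" for N
  have xv: "cinner (x N) (v p) = 0" if "p < q" for N p
  proof -
    have "cinner (\<Sum>i<q. scaleC (cinner (u N) (v i)) (v i)) (v p)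
        = (\<Sum>i<q. if i = p then cinner (u N) (v p) else 0)"
      unfolding cinner_sum_left cinner_scaleC_left
      using v that by (intro sum.cong refl) auto
    also have "\<dots> = cinner (u N) (v p)" using that by (subst sum.delta) auto
    finally show ?thesis by (simp add: x_def cinner_diff_left)
  qed
  have xu: "(\<lambda>N. x N - u N) \<longlonglongrightarrow> 0"
  proof -
    have "(\<lambda>N. \<Sum>p<q. scaleC (cinner (u N) (v p)) (v p)) \<longlonglongrightarrow> (\<Sum>p<q. 0)"
    proof (intro tendsto_sum)
      fix p
      have "(\<lambda>N. cinner (u N) (v p)) \<longlonglongrightarrow> 0"
        using tendsto_cnj[OF null_right[of "v p"]] by (subst cinner_commute) simp
      from bounded_linear.tendsto[OF bounded_linear_scaleC_left[of "v p"] this]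
      show "(\<lambda>N. scaleC (cinner (u N) (v p)) (v p)) \<longlonglongrightarrow> 0" by simp
    qed
    from tendsto_minus[OF this] show ?thesis by (simp add: x_def)
  qed
  have nu: "norm (u N) = 1" for N using norm_orthonormal_seq[OF u] .
  have nx: "(\<lambda>N. norm (x N)) \<longlonglongrightarrow> 1"
  proof (rule LIM_zero_cancel, rule tendsto_rabs_zero_cancel, rule tendsto_sandwich[OF _ _ tendsto_const])
    show "(\<lambda>N. norm (x N - u N)) \<longlonglongrightarrow> 0" using xu by (rule tendsto_norm_zero)
    show "\<forall>\<^sub>F N in sequentially. \<bar>norm (x N) - 1\<bar> \<le> norm (x N - u N)"
      using norm_triangle_ineq3[of "x _" "u _"] by (intro always_eventually allI) (simp add: nu)
  qed simp
  have wu: "(\<lambda>N. w N - u N) \<longlonglongrightarrow> 0"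
  proof -
    have "(\<lambda>N. norm ((inverse (norm (x N)) - 1) *\<^sub>R x N)) \<longlonglongrightarrow> \<bar>inverse 1 - 1\<bar> * 1"
      unfolding norm_scaleR by (intro tendsto_intros nx) simp
    then have "(\<lambda>N. (inverse (norm (x N)) - 1) *\<^sub>R x N) \<longlonglongrightarrow> 0"
      by (simp only: tendsto_norm_zero_iff abs_zero mult_zero_left inverse_1 diff_self)
    from tendsto_add[OF this xu] show ?thesis
      by (simp add: w_def scaleR_diff_left)
  qed
  have Awu: "(\<lambda>N. A (w N - u N)) \<longlonglongrightarrow> 0" for A :: "'h \<Rightarrow>\<^sub>L 'h"
    using bounded_linear.tendsto[OF blinfun.bounded_linear_right wu, of A] by simp
  have "(\<lambda>N. cinner (A (w N)) (v p)) \<longlonglongrightarrow> 0" if "A \<in> \<T>" for A p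
    using tendsto_add[OF tendsto_cinner[OF Awu[of A] tendsto_const[of "v p"]] null[OF cb[OF that], of "v p"]]
    by (simp add: blinfun.diff_right cinner_diff_left)
  then have e1: "\<forall>\<^sub>F N in sequentially. cmod (cinner (A (w N)) (v p)) < \<epsilon>" if "A \<in> \<T>" for A p
    using that \<open>\<epsilon> > 0\<close> by (metis order_tendstoD(2) tendsto_norm_zero)
  have "(\<lambda>N. cinner (A (v p)) (w N)) \<longlonglongrightarrow> 0" for A :: "'h \<Rightarrow>\<^sub>L 'h" and p
    using tendsto_add[OF tendsto_cinner[OF tendsto_const[of "A (v p)"] wu] null_right[of "A (v p)"]]
    by (simp add: cinner_diff_right)
  then have e2: "\<forall>\<^sub>F N in sequentially. cmod (cinner (A (v p)) (w N)) < \<epsilon>" for A :: "'h \<Rightarrow>\<^sub>L 'h" and p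
    using \<open>\<epsilon> > 0\<close> by (metis order_tendstoD(2) tendsto_norm_zero)
  have nw: "norm (w N) \<le> 1" for N by (cases "x N = 0") (simp_all add: w_def)
  have Twu: "(\<lambda>N. cinner (T (w N)) (w N) - cinner (T (u N)) (u N)) \<longlonglongrightarrow> 0"
  proof (rule tendsto_norm_zero_cancel, rule tendsto_sandwich[OF _ _ tendsto_const])
    have "(\<lambda>N. 2 * norm T * norm (w N - u N)) \<longlonglongrightarrow> 2 * norm T * 0"
      by (intro tendsto_intros tendsto_norm_zero wu)
    then show "(\<lambda>N. 2 * norm T * norm (w N - u N)) \<longlonglongrightarrow> 0" by simp
    show "\<forall>\<^sub>F N in sequentially. cmod (cinner (T (w N)) (w N) - cinner (T (u N)) (u N)) \<le> 2 * norm T * norm (w N - u N)"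
    proof (intro always_eventually allI)
      fix N
      have "cinner (T (w N)) (w N) - cinner (T (u N)) (u N)
          = cinner (T (w N - u N)) (w N) + cinner (T (u N)) (w N - u N)"
        by (simp add: blinfun.diff_right cinner_diff_left cinner_diff_right)
      also have "cmod \<dots> \<le> norm T * norm (w N - u N) * 1 + norm T * 1 * norm (w N - u N)"
      proof (rule norm_triangle_le, rule add_mono)
        show "cmod (cinner (T (w N - u N)) (w N)) \<le> norm T * norm (w N - u N) * 1"
          by (rule order_trans[OF cinner_Cauchy_Schwarz]) (intro mult_mono norm_blinfun nw, auto)
        show "cmod (cinner (T (u N)) (w N - u N)) \<le> norm T * 1 * norm (w N - u N)"
          using norm_blinfun[of T "u N"]
          by (intro order_trans[OF cinner_Cauchy_Schwarz] mult_right_mono) (auto simp: nu)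
      qed
      finally show "cmod (cinner (T (w N)) (w N) - cinner (T (u N)) (u N)) \<le> 2 * norm T * norm (w N - u N)"
        by simp
    qed
  qed simp
  have "(\<lambda>N. cinner (T (w N)) (w N) - \<mu>) \<longlonglongrightarrow> 0"
    using tendsto_diff[OF tendsto_add[OF Twu uT] tendsto_const[of \<mu>]] by simp
  then have e3: "\<forall>\<^sub>F N in sequentially. cmod (cinner (T (w N)) (w N) - \<mu>) < \<epsilon>"
    using \<open>\<epsilon> > 0\<close> by (metis order_tendstoD(2) tendsto_norm_zero)
  \<comment> \<open>This excludes the indices with \<open>x N = 0\<close>, where normalisation would
    give zero instead of a unit vector.\<close>
  have e4: "\<forall>\<^sub>F N in sequentially. norm (x N) > 0"
    using nx by (rule order_tendstoD) simp
  have "\<forall>\<^sub>F N in sequentially. (\<forall>A\<in>\<T>. \<forall>p\<in>{..<q}. cmod (cinner (A (w N)) (v p)) < \<epsilon> \<and>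
      cmod (cinner (A (v p)) (w N)) < \<epsilon>) \<and> cmod (cinner (T (w N)) (w N) - \<mu>) < \<epsilon> \<and> norm (x N) > 0"
    using e1 e2 e3 e4 \<open>finite \<T>\<close>
    by (intro eventually_conj eventually_ball_finite ballI) auto
  then obtain N where N: "\<forall>A\<in>\<T>. \<forall>p\<in>{..<q}. cmod (cinner (A (w N)) (v p)) < \<epsilon> \<and>
      cmod (cinner (A (v p)) (w N)) < \<epsilon>" "cmod (cinner (T (w N)) (w N) - \<mu>) < \<epsilon>" "norm (x N) > 0"
    using eventually_happens'[OF sequentially_bot] by blast
  show ?thesis
    using N by (intro exI[of _ "w N"]) (auto simp: w_def cinner_scaleR_left xv)
qed

text \<open>The vectors are chosen one after another by \<open>exists_fresh_vector\<close>.
  Compactness of the path \<open>A\<close> reduces the estimates over all times to a finite net of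
  operators: half of the tolerance goes to the distance from the net, half to the fresh
  vector.\<close>

lemma exists_almost_diagonal_seq:
  fixes A :: "real \<Rightarrow> 'h::complex_inner \<Rightarrow>\<^sub>L 'h"
  assumes cont: "continuous_on {0..1} A" and cb: "\<And>t. t \<in> {0..1} \<Longrightarrow> is_cbounded_op (A t)"
    and lam: "\<And>q. \<mu> q \<in> ess_num_range (A (\<tau> q))" and eps: "\<And>q. \<epsilon> q > 0"
  shows "\<exists>v. orthonormal_seq v \<and>
    (\<forall>t\<in>{0..1}. \<forall>q. \<forall>p<q. cmod (cinner (A t (v p)) (v q)) \<le> \<epsilon> q \<and> cmod (cinner (A t (v q)) (v p)) \<le> \<epsilon> q) \<and>
    (\<forall>q::nat. cmod (cinner (A (\<tau> q) (v q)) (v q) - \<mu> q) \<le> \<epsilon> q)"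
proof -
  define P where "P f q r \<longleftrightarrow> norm r = 1 \<and> (\<forall>p<q. cinner r (f p) = 0) \<and>
    (\<forall>t\<in>{0..1}. \<forall>p<q. cmod (cinner (A t (f p)) r) \<le> \<epsilon> q \<and> cmod (cinner (A t r) (f p)) \<le> \<epsilon> q) \<and>
    cmod (cinner (A (\<tau> q) r) r - \<mu> q) \<le> \<epsilon> q" for f :: "nat \<Rightarrow> 'h" and q r
  have "\<exists>f. \<forall>q. P f q (f q)"
  proof (rule dependent_wellorder_choice)
    show "P f x r = P g x r" if "\<And>y. y < x \<Longrightarrow> f y = g y" for r f g x
      using that by (simp add: P_def)
  next
    fix q and f :: "nat \<Rightarrow> 'h"
    assume IH: "\<And>y. y < q \<Longrightarrow> P f y (f y)"
    have nf: "norm (f i) = 1" if "i < q" for i using IH[OF that] by (auto simp: P_def)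
    have orth: "cinner (f i) (f j) = (if i = j then 1 else 0)" if "i < q" "j < q" for i j
      using IH[OF that(1)] IH[OF that(2)] that
      by (cases i j rule: linorder_cases) (auto simp: P_def cinner_self intro: cinner_commute_zero)
    have "compact (A ` {0..1})" using cont by (intro compact_continuous_image) auto
    then have "\<exists>\<T>. finite \<T> \<and> \<T> \<subseteq> A ` {0..1} \<and> A ` {0..1} \<subseteq> (\<Union>B\<in>\<T>. ball B (\<epsilon> q / 2))"
      using eps[of q]
      by (intro seq_compact_imp_totally_bounded[rule_format]) (simp_all add: compact_eq_seq_compact_metric)
    then obtain \<T> where \<T>: "finite \<T>" "\<T> \<subseteq> A ` {0..1}" "A ` {0..1} \<subseteq> (\<Union>B\<in>\<T>. ball B (\<epsilon> q / 2))"
      by blast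
    have "\<exists>w. norm w = 1 \<and> (\<forall>p<q. cinner w (f p) = 0) \<and>
      (\<forall>B\<in>\<T>. \<forall>p<q. cmod (cinner (B w) (f p)) < \<epsilon> q / 2 \<and> cmod (cinner (B (f p)) w) < \<epsilon> q / 2) \<and>
      cmod (cinner (A (\<tau> q) w) w - \<mu> q) < \<epsilon> q / 2"
      using cb \<T>(2) orth eps[of q] by (intro exists_fresh_vector lam \<T>(1)) auto
    then obtain w where w: "norm w = 1" "\<And>p. p < q \<Longrightarrow> cinner w (f p) = 0"
      "\<And>B p. B \<in> \<T> \<Longrightarrow> p < q \<Longrightarrow> cmod (cinner (B w) (f p)) < \<epsilon> q / 2 \<and> cmod (cinner (B (f p)) w) < \<epsilon> q / 2"
      "cmod (cinner (A (\<tau> q) w) w - \<mu> q) < \<epsilon> q / 2"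
      by blast
    have "cmod (cinner (A t x) y) \<le> \<epsilon> q"
      if t: "t \<in> {0..1}" and xy: "norm x = 1" "norm y = 1" "\<And>B. B \<in> \<T> \<Longrightarrow> cmod (cinner (B x) y) < \<epsilon> q / 2" for t x y
    proof -
      have "A t \<in> (\<Union>B\<in>\<T>. ball B (\<epsilon> q / 2))" using \<T>(3) t by blast
      then obtain B where B: "B \<in> \<T>" "norm (A t - B) < \<epsilon> q / 2"
        by (auto simp: dist_norm norm_minus_commute)
      have "cinner (A t x) y = cinner ((A t - B) x) y + cinner (B x) y"
        by (simp add: blinfun.diff_left cinner_diff_left)
      also have "cmod \<dots> \<le> norm (A t - B) + \<epsilon> q / 2"
      proof (rule norm_triangle_le, rule add_mono)
        show "cmod (cinner ((A t - B) x) y) \<le> norm (A t - B)"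
          using cinner_Cauchy_Schwarz[of "(A t - B) x" y] norm_blinfun[of "A t - B" x] xy by simp
      qed (use xy(3)[OF B(1)] in simp)
      finally show ?thesis using B(2) by simp
    qed
    then have "P f q w" unfolding P_def using w nf eps[of q] by auto
    then show "\<exists>r. P f q r" ..
  qed
  then obtain v where v: "\<And>q. P v q (v q)" by auto
  have "cinner (v i) (v j) = (if i = j then 1 else 0)" for i j
    using v[of i] v[of j]
    by (cases i j rule: linorder_cases) (auto simp: P_def cinner_self intro: cinner_commute_zero)
  then show ?thesis
    using v by (intro exI[of _ v]) (auto simp: P_def orthonormal_seq_def)
qed

section \<open>Isometries with prescribed approximate compressions\<close>

lemma sum_quarter_powers_le: "(\<Sum>i<n. (1/4::real)^i) \<le> 4/3"
  using sum_le_suminf[of "\<lambda>i. (1/4::real)^i" "{..<n}"] suminf_geometric[of "1/4::real"] by simp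

text \<open>The coefficients are bounded by the norms of \<open>z\<close> and \<open>w\<close>, and
  the entries decay geometrically in both indices, so absolute summation suffices. The constant 2
  covers (4/3)^2.\<close>

lemma cmod_sesquilinear_sum_le:
  assumes e: "orthogonal_seq e" and "\<kappa> \<ge> 0"
    and M: "\<And>i j. cmod (M i j) \<le> \<kappa> * (1/4)^i * (1/4)^j"
  shows "cmod (\<Sum>i<N. \<Sum>j<N. cinner z (e i) * (cnj (cinner w (e j)) * M i j)) \<le> 2 * \<kappa> * norm z * norm w"
proof -
  have b: "cmod (cinner x (e i)) \<le> norm x" for x i
    using cinner_Cauchy_Schwarz[of x "e i"] e mult_left_le[of "norm (e i)" "norm x"]
    by (auto simp: orthogonal_seq_def intro: order_trans)
  have "cmod (\<Sum>i<N. \<Sum>j<N. cinner z (e i) * (cnj (cinner w (e j)) * M i j))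
      \<le> (\<Sum>i<N. \<Sum>j<N. norm z * (norm w * (\<kappa> * (1/4)^i * (1/4)^j)))"
    unfolding norm_mult
    by (intro order_trans[OF norm_sum] sum_mono) (auto simp: norm_mult intro!: mult_mono M b mult_nonneg_nonneg \<open>\<kappa> \<ge> 0\<close>)
  also have "\<dots> = norm z * norm w * \<kappa> * ((\<Sum>i<N. (1/4)^i) * (\<Sum>j<N. (1/4)^j))"
    by (simp add: sum_product sum_distrib_left mult_ac)
  also have "\<dots> \<le> norm z * norm w * \<kappa> * ((4/3) * (4/3))"
    using \<open>\<kappa> \<ge> 0\<close> by (intro mult_left_mono mult_mono sum_quarter_powers_le) (auto intro: sum_nonneg)
  also have "\<dots> \<le> norm z * norm w * \<kappa> * 2"
    using \<open>\<kappa> \<ge> 0\<close> by (intro mult_left_mono) auto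
  finally show ?thesis by (simp add: mult_ac)
qed

lemma triangle_ge: "n \<le> triangle n"
  by (induction n) auto

text \<open>One almost diagonal sequence is cut into infinitely many subsequences by pairing
  indices, and \<open>U y\<close> uses the coefficients of its argument along \<open>e\<close> as
  coefficients along subsequence \<open>y\<close>. Distinct subsequences are mutually orthogonal,
  and the decay of the matrix entries turns into operator bounds.\<close>

lemma exists_isometry_family:
  fixes A :: "real \<Rightarrow> 'h::{complex_inner,complete_space} \<Rightarrow>\<^sub>L 'h"
  assumes sep: "separable_space (euclidean :: 'z::{complex_inner,complete_space} topology)"
    and cont: "continuous_on {0..1} A" and cb: "\<And>t. t \<in> {0..1} \<Longrightarrow> is_cbounded_op (A t)"
    and tau: "\<And>y. \<tau> y \<in> {0..1}" and mu: "\<And>y. \<mu> y \<in> ess_num_range (A (\<tau> y))" and "\<eta> > 0"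
  shows "\<exists>U :: nat \<Rightarrow> 'z \<Rightarrow>\<^sub>L 'h. (\<forall>y. is_cbounded_op (U y)) \<and>
    (\<forall>y y' z w. cinner (U y z) (U y' w) = (if y = y' then cinner z w else 0)) \<and>
    (\<forall>t\<in>{0..1}. \<forall>y y' z w. y \<noteq> y' \<longrightarrow>
      cmod (cinner (A t (U y z)) (U y' w)) \<le> \<eta> * (1/4)^y * (1/4)^y' * norm z * norm w) \<and>
    (\<forall>y z w. cmod (cinner (A (\<tau> y) (U y z)) (U y w) - \<mu> y * cinner z w) \<le> \<eta> * norm z * norm w)"
proof -
  obtain e :: "nat \<Rightarrow> 'z" where "orthogonal_basis e"
    using separable_imp_orthogonal_basis[OF sep] by blast
  then have eo: "orthogonal_seq e" and ex: "\<And>x. (\<lambda>N. \<Sum>i<N. scaleC (cinner x (e i)) (e i)) \<longlonglongrightarrow> x"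
    by (auto simp: orthogonal_basis_def)
  \<comment> \<open>Position \<open>prod_encode (y, i)\<close> belongs to isometry \<open>y\<close>
    and inherits the time and the point prescribed for \<open>y\<close>.\<close>
  define idx where "idx q = fst (prod_decode q)" for q
  \<comment> \<open>For p <= q the rate (1/16)^q is at most (1/4)^p (1/4)^q, which
    \<open>enc\<close> splits into separate decay in both indices of each pair. The factor 1/2
    compensates for the 2 in \<open>cmod_sesquilinear_sum_le\<close>.\<close>
  have "\<exists>v. orthonormal_seq v \<and>
    (\<forall>t\<in>{0..1}. \<forall>q. \<forall>p<q. cmod (cinner (A t (v p)) (v q)) \<le> \<eta> / 2 * (1/16)^q \<and>
       cmod (cinner (A t (v q)) (v p)) \<le> \<eta> / 2 * (1/16)^q) \<and>
    (\<forall>q. cmod (cinner (A (\<tau> (idx q)) (v q)) (v q) - \<mu> (idx q)) \<le> \<eta> / 2 * (1/16)^q)"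
    using mu \<open>\<eta> > 0\<close> by (intro exists_almost_diagonal_seq cont cb) auto
  then obtain v where v: "orthonormal_seq v"
    and voff: "\<And>t p q. t \<in> {0..1} \<Longrightarrow> p < q \<Longrightarrow> cmod (cinner (A t (v p)) (v q)) \<le> \<eta> / 2 * (1/16)^q \<and>
       cmod (cinner (A t (v q)) (v p)) \<le> \<eta> / 2 * (1/16)^q"
    and vdiag: "\<And>q. cmod (cinner (A (\<tau> (idx q)) (v q)) (v q) - \<mu> (idx q)) \<le> \<eta> / 2 * (1/16)^q"
    by blast
  define u where "u y i = v (prod_encode (y, i))" for y i
  have uo: "orthogonal_seq (u y)" for y
    using orthonormal_imp_orthogonal_seq[OF v] by (auto simp: orthogonal_seq_def u_def)
  have uu: "cinner (u y i) (u y' j) = (if y = y' \<and> i = j then 1 else 0)" for y i y' j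
    using v by (auto simp: orthonormal_seq_def u_def)
  have enc: "(1/4::real) ^ prod_encode (y, i) \<le> (1/4)^y * (1/4)^i" for y i
  proof -
    have "y + i \<le> prod_encode (y, i)"
      using triangle_ge[of "y + i"] by (simp add: prod_encode_def)
    then have "(1/4::real) ^ prod_encode (y, i) \<le> (1/4)^(y + i)" by (intro power_decreasing) auto
    then show ?thesis by (simp add: power_add)
  qed
  have pw: "(1/16::real)^q \<le> (1/4)^p * (1/4)^q" if "p \<le> q" for p q :: nat
  proof -
    have "(1/16::real)^q = (1/4)^q * (1/4)^q" by (simp flip: power_mult_distrib)
    also have "\<dots> \<le> (1/4)^p * (1/4)^q" using that by (intro mult_right_mono power_decreasing) auto
    finally show ?thesis .
  qed
  have voff': "cmod (cinner (A t (v p)) (v q)) \<le> \<eta> / 2 * ((1/4)^p * (1/4)^q)"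
    if "t \<in> {0..1}" "p \<noteq> q" for t p q
  proof (cases "p < q")
    case True
    have "\<eta> / 2 * (1/16)^q \<le> \<eta> / 2 * ((1/4)^p * (1/4)^q)"
      using pw[of p q] True \<open>\<eta> > 0\<close> by (intro mult_left_mono) auto
    then show ?thesis using voff[OF that(1) True] by linarith
  next
    case False
    then have "q < p" using that by simp
    have "\<eta> / 2 * (1/16)^p \<le> \<eta> / 2 * ((1/4)^q * (1/4)^p)"
      using pw[of q p] \<open>q < p\<close> \<open>\<eta> > 0\<close> by (intro mult_left_mono) auto
    then show ?thesis using voff[OF that(1) \<open>q < p\<close>] by (simp add: mult.commute) 
  qed
  have uoff: "cmod (cinner (A t (u y i)) (u y' j)) \<le> \<eta> / 2 * (1/4)^y * (1/4)^y' * (1/4)^i * (1/4)^j"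
    if "t \<in> {0..1}" "(y, i) \<noteq> (y', j)" for t y i y' j
  proof -
    have "cmod (cinner (A t (u y i)) (u y' j)) \<le> \<eta> / 2 * ((1/4) ^ prod_encode (y, i) * (1/4) ^ prod_encode (y', j))"
      unfolding u_def using that(2) by (intro voff' that(1)) (metis prod_encode_eq)
    also have "\<dots> \<le> \<eta> / 2 * (((1/4)^y * (1/4)^i) * ((1/4)^y' * (1/4)^j))"
      using \<open>\<eta> > 0\<close> by (intro mult_left_mono mult_mono enc) auto
    finally show ?thesis by (simp add: mult_ac)
  qed
  have udiag: "cmod (cinner (A (\<tau> y) (u y i)) (u y i) - \<mu> y) \<le> \<eta> / 2 * (1/4)^i * (1/4)^i" for y i
  proof -
    define q where "q = prod_encode (y, i)"
    have "cmod (cinner (A (\<tau> y) (u y i)) (u y i) - \<mu> y) \<le> \<eta> / 2 * (1/16)^q"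
      using vdiag[of q] by (simp add: q_def u_def idx_def)
    also have "\<dots> \<le> \<eta> / 2 * (1/16)^i"
      using le_prod_encode_2[of i y] \<open>\<eta> > 0\<close> unfolding q_def
      by (intro mult_left_mono power_decreasing) auto
    also have "\<dots> = \<eta> / 2 * (1/4)^i * (1/4)^i" by (simp flip: power_mult_distrib)
    finally show ?thesis .
  qed
  \<comment> \<open>Inner products of the \<open>G y N\<close> reduce to those of the partial
    expansions \<open>E N\<close>. This gives the isometry property even when some
    \<open>e i\<close> vanish although all \<open>u y i\<close> are unit vectors.\<close>
  define E where "E N z = (\<Sum>i<N. scaleC (cinner z (e i)) (e i))" for N z
  define G where "G y N z = (\<Sum>i<N. scaleC (cinner z (e i)) (u y i))" for y N z
  define g where "g y z = lim (\<lambda>N. G y N z)" for y z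
  have G: "(\<lambda>N. G y N z) \<longlonglongrightarrow> g y z" for y z
    using convergent_orthonormal_expansion[OF eo uo, of z y]
    unfolding g_def G_def convergent_LIMSEQ_iff .
  have Gform: "cinner (B (G y N z)) (G y' N w)
      = (\<Sum>i<N. \<Sum>j<N. cinner z (e i) * (cnj (cinner w (e j)) * cinner (B (u y i)) (u y' j)))"
    if "is_cbounded_op B" for B :: "'h \<Rightarrow>\<^sub>L 'h" and y N z y' w
    by (simp add: G_def blinfun.sum_right is_cbounded_op_scaleC[OF that] cinner_sum_left cinner_sum_right
        cinner_scaleC_left cinner_scaleC_right sum_distrib_left mult_ac)
      (subst sum.swap, simp)
  have EG: "cinner (E N z) w = (\<Sum>i<N. \<Sum>j<N. cinner z (e i) * (cnj (cinner w (e j)) * (if i = j then 1 else 0)))" for N z w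
  proof -
    have "cnj (cinner w (e i)) = cinner (e i) w" for i by (subst cinner_commute) simp
    then show ?thesis
      by (simp add: E_def cinner_sum_left cinner_scaleC_left if_distrib[of "\<lambda>x. _ * x"] cong: if_cong)
  qed
  have Elim: "(\<lambda>N. cinner (E N z) w) \<longlonglongrightarrow> cinner z w" for z w
    unfolding E_def by (intro tendsto_cinner ex tendsto_const)
  have inner: "cinner (g y z) (g y' w) = (if y = y' then cinner z w else 0)" for y y' z w
  proof (rule LIMSEQ_unique)
    show "(\<lambda>N. cinner (G y N z) (G y' N w)) \<longlonglongrightarrow> cinner (g y z) (g y' w)"
      by (intro tendsto_cinner G)
    have "is_cbounded_op (id_blinfun :: 'h \<Rightarrow>\<^sub>L 'h)" by (simp add: is_cbounded_op_def)
    from Gform[OF this, of y _ z y' w]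
    have "cinner (G y N z) (G y' N w) = (if y = y' then cinner (E N z) w else 0)" for N
      by (simp add: uu EG)
    then show "(\<lambda>N. cinner (G y N z) (G y' N w)) \<longlonglongrightarrow> (if y = y' then cinner z w else 0)"
      using Elim by simp
  qed
  have gC: "g y (scaleC c z) = scaleC c (g y z)" for y c z
  proof (rule LIMSEQ_unique[OF G])
    have "G y N (scaleC c z) = scaleC c (G y N z)" for N
      by (simp add: G_def cinner_scaleC_left scaleC_sum_right scaleC_scaleC)
    then show "(\<lambda>N. G y N (scaleC c z)) \<longlonglongrightarrow> scaleC c (g y z)"
      using tendsto_scaleC_right[OF G] by simp
  qed
  have bl: "bounded_linear (g y)" for y
  proof (rule bounded_linear_intro[where K = 1])
    show "g y (z + w) = g y z + g y w" for z w
    proof (rule LIMSEQ_unique[OF G])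
      have "G y N (z + w) = G y N z + G y N w" for N
        by (simp add: G_def cinner_add_left scaleC_add_left sum.distrib)
      then show "(\<lambda>N. G y N (z + w)) \<longlonglongrightarrow> g y z + g y w"
        using tendsto_add[OF G G] by simp
    qed
    show "g y (r *\<^sub>R z) = r *\<^sub>R g y z" for r z by (metis gC scaleC_of_real)
    have "(norm (g y z))\<^sup>2 = (norm z)\<^sup>2" for z
      using inner[of y z y z] unfolding cinner_self by (simp flip: of_real_power)
    then show "norm (g y z) \<le> norm z * 1" for z by simp
  qed
  define U where "U y = Blinfun (g y)" for y
  have U: "U y z = g y z" for y z by (simp add: U_def bounded_linear_Blinfun_apply[OF bl])
  \<comment> \<open>Used with \<open>\<alpha>\<close> equal to 0 for two different isometries and to
    \<open>\<mu> y\<close> for a single one. The bound passes from finite sections to the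
    limit.\<close>
  have bound: "cmod (cinner (A t (g y z)) (g y' w) - \<alpha> * cinner z w) \<le> 2 * \<kappa> * norm z * norm w"
    if t: "t \<in> {0..1}" and k: "\<kappa> \<ge> 0"
      and M: "\<And>i j. cmod (cinner (A t (u y i)) (u y' j) - \<alpha> * (if i = j then 1 else 0)) \<le> \<kappa> * (1/4)^i * (1/4)^j"
    for t y y' z w \<alpha> \<kappa>
  proof (rule LIMSEQ_le_const2)
    show "(\<lambda>N. cmod (cinner (A t (G y N z)) (G y' N w) - \<alpha> * cinner (E N z) w))
        \<longlonglongrightarrow> cmod (cinner (A t (g y z)) (g y' w) - \<alpha> * cinner z w)"
      by (intro tendsto_norm tendsto_diff tendsto_mult tendsto_const Elim tendsto_cinner G
          bounded_linear.tendsto[OF blinfun.bounded_linear_right])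
    have "cinner (A t (G y N z)) (G y' N w) - \<alpha> * cinner (E N z) w
      = (\<Sum>i<N. \<Sum>j<N. cinner z (e i) * (cnj (cinner w (e j)) * (cinner (A t (u y i)) (u y' j) - \<alpha> * (if i = j then 1 else 0))))" for N
      unfolding Gform[OF cb[OF t]] EG sum_distrib_left sum_subtractf[symmetric]
      by (simp add: algebra_simps)
    then show "\<exists>N0. \<forall>N\<ge>N0. cmod (cinner (A t (G y N z)) (G y' N w) - \<alpha> * cinner (E N z) w) \<le> 2 * \<kappa> * norm z * norm w"
      using cmod_sesquilinear_sum_le[OF eo k M] by auto
  qed
  show ?thesis
  proof (intro exI[of _ U] conjI allI ballI impI)
    show "is_cbounded_op (U y)" for y by (simp add: is_cbounded_op_def U gC)
    show "cinner (U y z) (U y' w) = (if y = y' then cinner z w else 0)" for y y' z w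
      by (simp add: U inner)
    show "cmod (cinner (A t (U y z)) (U y' w)) \<le> \<eta> * (1/4)^y * (1/4)^y' * norm z * norm w"
      if "t \<in> {0..1}" "y \<noteq> y'" for t y y' z w
      using bound[OF that(1), of "\<eta> / 2 * (1/4)^y * (1/4)^y'" y y' 0 z w] uoff[OF that(1)] that(2) \<open>\<eta> > 0\<close>
      by (simp add: U)
    show "cmod (cinner (A (\<tau> y) (U y z)) (U y w) - \<mu> y * cinner z w) \<le> \<eta> * norm z * norm w" for y z w
    proof -
      have le1: "(1/4::real)^y * (1/4)^y \<le> 1" by (intro mult_le_one power_le_one) auto
      have "cmod (cinner (A (\<tau> y) (u y i)) (u y j) - \<mu> y * (if i = j then 1 else 0)) \<le> \<eta> / 2 * (1/4)^i * (1/4)^j" for i j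
      proof (cases "i = j")
        case False
        have "\<eta> / 2 * (1/4)^i * (1/4)^j * ((1/4)^y * (1/4)^y) \<le> \<eta> / 2 * (1/4)^i * (1/4)^j"
          using le1 \<open>\<eta> > 0\<close> by (intro mult_left_le) auto
        then show ?thesis using uoff[OF tau[of y], of y i y j] False by (simp add: mult_ac)
      qed (use udiag[of y i] in simp)
      then show ?thesis using bound[OF tau[of y], of "\<eta> / 2" y y "\<mu> y" z w] \<open>\<eta> > 0\<close> by (simp add: U)
    qed
  qed
qed

text \<open>The library proves completeness only for codomains of class \<open>banach\<close>, and the sort
\<open>{complex_inner, complete_space}\<close> is not a subsort of \<open>banach\<close>.\<close>

instance blinfun :: (real_normed_vector, "{real_normed_vector, complete_space}") complete_space
proof
  fix X :: "nat \<Rightarrow> 'a \<Rightarrow>\<^sub>L 'b"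
  assume X: "Cauchy X"
  have "convergent (\<lambda>n. X n x)" for x
  proof -
    have "Cauchy (\<lambda>n. X n x)"
      using bounded_linear.Cauchy[OF blinfun.bounded_linear_left X] .
    then show ?thesis by (simp add: Cauchy_convergent_iff)
  qed
  then obtain g where g: "\<And>x. (\<lambda>n. X n x) \<longlonglongrightarrow> g x"
    unfolding convergent_def by metis
  obtain K where K: "\<And>n. norm (X n) \<le> K"
    using Cauchy_Bseq[OF X] by (auto simp: Bseq_def)
  have bl: "bounded_linear g"
  proof (rule bounded_linear_intro[where K = K])
    show "g (x + y) = g x + g y" for x y
      using g[of "x + y"] tendsto_add[OF g[of x] g[of y]]
      by (simp add: blinfun.add_right LIMSEQ_unique)
    show "g (r *\<^sub>R x) = r *\<^sub>R g x" for r x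
      using g[of "r *\<^sub>R x"] tendsto_scaleR[OF tendsto_const g[of x], of r]
      by (simp add: blinfun.scaleR_right LIMSEQ_unique)
    show "norm (g x) \<le> norm x * K" for x
    proof (rule LIMSEQ_le_const2[OF tendsto_norm[OF g]])
      show "\<exists>N. \<forall>n\<ge>N. norm (X n x) \<le> norm x * K"
        using mult_right_mono[OF K norm_ge_zero[of x]] norm_blinfun[of "X _" x]
        by (auto simp: mult.commute intro: order_trans)
    qed
  qed
  have "X \<longlonglongrightarrow> Blinfun g"
  proof (rule metric_LIMSEQ_I)
    fix r :: real assume "r > 0"
    then obtain N where N: "\<And>m n. m \<ge> N \<Longrightarrow> n \<ge> N \<Longrightarrow> norm (X m - X n) < r / 2"
      using CauchyD[OF X, of "r / 2"] by auto
    have "dist (X n) (Blinfun g) < r" if "n \<ge> N" for n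
    proof -
      have "norm (X n - Blinfun g) \<le> r / 2"
      proof (rule norm_blinfun_bound)
        fix x
        show "norm ((X n - Blinfun g) x) \<le> r / 2 * norm x"
        proof (rule LIMSEQ_le_const2)
          show "(\<lambda>m. norm (X n x - X m x)) \<longlonglongrightarrow> norm ((X n - Blinfun g) x)"
            unfolding blinfun.diff_left bounded_linear_Blinfun_apply[OF bl]
            by (intro tendsto_intros g)
          have "norm (X n x - X m x) \<le> r / 2 * norm x" if "m \<ge> N" for m
            using norm_blinfun[of "X n - X m" x]
              mult_right_mono[OF less_imp_le[OF N[OF \<open>n \<ge> N\<close> that]] norm_ge_zero[of x]]
            unfolding blinfun.diff_left by linarith
          then show "\<exists>N. \<forall>m\<ge>N. norm (X n x - X m x) \<le> r / 2 * norm x" by blast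
        qed
      qed (use \<open>r > 0\<close> in simp)
      then show ?thesis using \<open>r > 0\<close> by (simp add: dist_norm)
    qed
    then show "\<exists>N. \<forall>n\<ge>N. dist (X n) (Blinfun g) < r" by blast
  qed
  then show "convergent X" by (rule convergentI)
qed

subsection \<open>Defect operators\<close>

lemma is_cbounded_op_id: "is_cbounded_op id_blinfun"
  by (simp add: is_cbounded_op_def)

lemma is_cbounded_op_0: "is_cbounded_op 0"
  by (simp add: is_cbounded_op_def)

lemma is_cbounded_op_add: "is_cbounded_op S \<Longrightarrow> is_cbounded_op T \<Longrightarrow> is_cbounded_op (S + T)"
  by (simp add: is_cbounded_op_def blinfun.add_left scaleC_add_right)

lemma is_cbounded_op_diff: "is_cbounded_op S \<Longrightarrow> is_cbounded_op T \<Longrightarrow> is_cbounded_op (S - T)"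
  by (simp add: is_cbounded_op_def blinfun.diff_left scaleC_diff_right)

lemma is_cbounded_op_scaleR: "is_cbounded_op T \<Longrightarrow> is_cbounded_op (r *\<^sub>R T)"
  by (simp add: is_cbounded_op_def blinfun.scaleR_left scaleC_scaleR)

lemma is_cbounded_op_compose: "is_cbounded_op S \<Longrightarrow> is_cbounded_op T \<Longrightarrow> is_cbounded_op (S o\<^sub>L T)"
  by (simp add: is_cbounded_op_def)

lemma is_cbounded_op_sum: "(\<And>i. i \<in> I \<Longrightarrow> is_cbounded_op (T i)) \<Longrightarrow> is_cbounded_op (\<Sum>i\<in>I. T i)"
  by (induction I rule: infinite_finite_induct) (auto intro: is_cbounded_op_add is_cbounded_op_0)

lemma is_cbounded_op_LIMSEQ:
  assumes "\<And>n. is_cbounded_op (X n)" "X \<longlonglongrightarrow> T"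
  shows "is_cbounded_op T"
  unfolding is_cbounded_op_def
proof (intro allI)
  fix c x
  have lim: "(\<lambda>n. X n y) \<longlonglongrightarrow> T y" for y
    using bounded_linear.tendsto[OF blinfun.bounded_linear_left assms(2)] .
  have "(\<lambda>n. X n (scaleC c x)) \<longlonglongrightarrow> scaleC c (T x)"
    using tendsto_scaleC_right[OF lim] assms(1) by (simp add: is_cbounded_op_scaleC)
  then show "T (scaleC c x) = scaleC c (T x)" using lim LIMSEQ_unique by blast
qed

lemmas continuous_on_blinfun_compose = bounded_bilinear.continuous_on[OF bounded_bilinear_blinfun_compose]

text \<open>With \<open>P = 1 - R\<close>, the equation \<open>R\<^sup>2 = 1 - Q\<close> becomes the fixed point equation
\<open>P = (Q + P\<^sup>2) / 2\<close>, a contraction on the self-adjoint operators of norm at most \<open>q < 1\<close>.\<close>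

lemma norm_compose_self_diff_le:
  fixes P P' :: "'a::real_normed_vector \<Rightarrow>\<^sub>L 'a"
  assumes "norm P \<le> q" "norm P' \<le> q"
  shows "norm ((P o\<^sub>L P) - (P' o\<^sub>L P')) \<le> 2 * q * norm (P - P')"
proof -
  have "(P o\<^sub>L P) - (P' o\<^sub>L P') = (P o\<^sub>L (P - P')) + ((P - P') o\<^sub>L P')"
    by (intro blinfun_eqI) (simp add: blinfun.bilinear_simps)
  also have "norm \<dots> \<le> norm P * norm (P - P') + norm (P - P') * norm P'"
    by (intro norm_triangle_le add_mono norm_blinfun_compose)
  also have "\<dots> \<le> q * norm (P - P') + norm (P - P') * q"
    using assms by (intro add_mono mult_right_mono mult_left_mono) auto
  finally show ?thesis by (simp add: mult_ac)
qed

lemma exists_defect_fixed_point: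
  fixes Q :: "'z::{complex_inner,complete_space} \<Rightarrow>\<^sub>L 'z"
  assumes Q: "is_cbounded_op Q" "\<And>z w. cinner (Q z) w = cinner z (Q w)" "norm Q \<le> q\<^sup>2"
    and q: "0 \<le> q" "q < 1"
  shows "\<exists>P. is_cbounded_op P \<and> (\<forall>z w. cinner (P z) w = cinner z (P w)) \<and> norm P \<le> q \<and>
    P = (1/2) *\<^sub>R (Q + (P o\<^sub>L P))"
proof -
  \<comment> \<open>Self-adjointness belongs to the set, so the fixed point inherits it. It is what
    allows the square of 1 - P to be read as the adjoint of 1 - P times 1 - P.\<close>
  define X where "X = {P :: 'z \<Rightarrow>\<^sub>L 'z. is_cbounded_op P \<and> (\<forall>z w. cinner (P z) w = cinner z (P w)) \<and> norm P \<le> q}"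
  define f where "f P = (1/2) *\<^sub>R (Q + (P o\<^sub>L P))" for P
  have "closed X"
    unfolding closed_sequential_limits
  proof (intro allI impI, elim conjE)
    fix S L assume S: "\<forall>n. S n \<in> X" and L: "S \<longlonglongrightarrow> L"
    have lim: "(\<lambda>n. S n y) \<longlonglongrightarrow> L y" for y
      using bounded_linear.tendsto[OF blinfun.bounded_linear_left L] .
    have "cinner (L z) w = cinner z (L w)" for z w
    proof (rule LIMSEQ_unique)
      show "(\<lambda>n. cinner (S n z) w) \<longlonglongrightarrow> cinner (L z) w" by (intro tendsto_cinner lim tendsto_const)
      have "(\<lambda>n. cinner z (S n w)) \<longlonglongrightarrow> cinner z (L w)" by (intro tendsto_cinner lim tendsto_const)
      then show "(\<lambda>n. cinner (S n z) w) \<longlonglongrightarrow> cinner z (L w)" using S by (simp add: X_def)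
    qed
    moreover have "is_cbounded_op L" using is_cbounded_op_LIMSEQ[OF _ L] S by (simp add: X_def)
    moreover have "norm L \<le> q"
      using S by (intro LIMSEQ_le_const2[OF tendsto_norm[OF L]]) (auto simp: X_def)
    ultimately show "L \<in> X" by (simp add: X_def)
  qed
  then have "complete X" by (simp add: complete_eq_closed)
  moreover have "0 \<in> X" using q by (simp add: X_def is_cbounded_op_0)
  moreover have "f ` X \<subseteq> X"
  proof (intro image_subsetI)
    fix P assume P: "P \<in> X"
    have "norm P * norm P \<le> q * q" using P q by (intro mult_mono) (auto simp: X_def)
    then have "norm (P o\<^sub>L P) \<le> q\<^sup>2"
      using norm_blinfun_compose[of P P] by (simp add: power2_eq_square)
    then have "norm (Q + (P o\<^sub>L P)) \<le> q\<^sup>2 + q\<^sup>2"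
      using Q(3) by (intro norm_triangle_le) simp
    moreover have "q\<^sup>2 \<le> q" using q by (simp add: power2_eq_square mult_left_le_one_le)
    ultimately have "norm (f P) \<le> q" by (simp add: f_def)
    then show "f P \<in> X"
      using P Q by (simp add: X_def f_def is_cbounded_op_scaleR is_cbounded_op_add is_cbounded_op_compose
          blinfun.bilinear_simps cinner_scaleR_left cinner_scaleR_right cinner_add_left cinner_add_right)
  qed
  \<comment> \<open>The factor 2q that comes from squaring is halved in \<open>f\<close>, which
    leaves the contraction constant \<open>q\<close>.\<close>
  moreover have "dist (f P) (f P') \<le> q * dist P P'" if "P \<in> X" "P' \<in> X" for P P'
  proof -
    have "f P - f P' = (1/2) *\<^sub>R ((P o\<^sub>L P) - (P' o\<^sub>L P'))"
      by (simp add: f_def algebra_simps)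
    then show ?thesis
      using norm_compose_self_diff_le[of P q P'] that by (simp add: dist_norm X_def)
  qed
  ultimately have "\<exists>!P. P \<in> X \<and> f P = P"
    using q by (intro Banach_fix[of X q f]) auto
  then obtain P where "P \<in> X" "f P = P" by blast
  then show ?thesis unfolding X_def f_def by (intro exI[of _ P]) auto
qed

text \<open>Subtracting the fixed point equations at two times shows that P depends on Q in a
  Lipschitz way with constant 1/(2(1 - q)). Fixed points picked separately at each time therefore
  form a continuous family, and R = 1 - P.\<close>

lemma exists_continuous_defect_operator:
  fixes T :: "real \<Rightarrow> 'z::{complex_inner,complete_space} \<Rightarrow>\<^sub>L 'z"
  assumes sep: "separable_space (euclidean :: 'z topology)"
    and cont: "continuous_on I T" and cb: "\<And>t. t \<in> I \<Longrightarrow> is_cbounded_op (T t)"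
    and nT: "\<And>t. t \<in> I \<Longrightarrow> norm (T t) \<le> q" and q: "0 \<le> q" "q < 1"
  shows "\<exists>R :: real \<Rightarrow> 'z \<Rightarrow>\<^sub>L 'z. continuous_on I R \<and> (\<forall>t\<in>I. is_cbounded_op (R t) \<and>
    (\<forall>z w. cinner (R t z) (R t w) = cinner z w - cinner (T t z) (T t w)))"
proof -
  define Q where "Q t = (adj (T t) o\<^sub>L T t)" for t
  have Qw: "cinner (Q t z) w = cinner (T t z) (T t w)" "cinner z (Q t w) = cinner (T t z) (T t w)"
    if "t \<in> I" for t z w
    using cinner_adj_left[OF sep cb[OF that]] cinner_adj_right[OF sep cb[OF that]] by (simp_all add: Q_def)
  have Qcb: "is_cbounded_op (Q t)" if "t \<in> I" for t
    using is_cbounded_op_adj[OF sep cb[OF that]] cb[OF that] by (simp add: Q_def is_cbounded_op_compose)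
  have nQ: "norm (Q t) \<le> q\<^sup>2" if "t \<in> I" for t
  proof -
    have "norm (Q t) \<le> norm (adj (T t)) * norm (T t)" unfolding Q_def by (rule norm_blinfun_compose)
    also have "\<dots> \<le> q * q"
      using norm_adj_le[OF sep cb[OF that]] nT[OF that] q by (intro mult_mono) auto
    finally show ?thesis by (simp add: power2_eq_square)
  qed
  have "\<exists>P. is_cbounded_op P \<and> (\<forall>z w. cinner (P z) w = cinner z (P w)) \<and> norm P \<le> q \<and>
    P = (1/2) *\<^sub>R (Q t + (P o\<^sub>L P))" if "t \<in> I" for t
    using Qcb[OF that] Qw[OF that] nQ[OF that] q by (intro exists_defect_fixed_point) auto
  then obtain P where P: "\<And>t. t \<in> I \<Longrightarrow> is_cbounded_op (P t)"
    "\<And>t z w. t \<in> I \<Longrightarrow> cinner (P t z) w = cinner z (P t w)" "\<And>t. t \<in> I \<Longrightarrow> norm (P t) \<le> q"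
    "\<And>t. t \<in> I \<Longrightarrow> P t = (1/2) *\<^sub>R (Q t + (P t o\<^sub>L P t))"
    by metis
  have P2: "P t + P t = Q t + (P t o\<^sub>L P t)" if "t \<in> I" for t
  proof -
    have "P t + P t = 2 *\<^sub>R ((1/2) *\<^sub>R (Q t + (P t o\<^sub>L P t)))" using P(4)[OF that] by (simp add: scaleR_2)
    then show ?thesis by simp
  qed
  have "continuous_on I Q"
    unfolding Q_def by (intro continuous_on_blinfun_compose continuous_on_adj sep cont cb)
  then have "continuous_on I P"
  proof (rule continuous_on_dist_le[of _ _ _ "1 / (2 * (1 - q))"])
    fix s t assume st: "s \<in> I" "t \<in> I"
    have "2 *\<^sub>R (P s - P t) = (Q s - Q t) + ((P s o\<^sub>L P s) - (P t o\<^sub>L P t))"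
      using P2[OF st(1)] P2[OF st(2)] by (simp add: scaleR_2 algebra_simps)
    then have "2 * norm (P s - P t) = norm ((Q s - Q t) + ((P s o\<^sub>L P s) - (P t o\<^sub>L P t)))"
      by (metis norm_scaleR abs_numeral)
    also have "\<dots> \<le> norm (Q s - Q t) + 2 * q * norm (P s - P t)"
      using norm_compose_self_diff_le[OF P(3)[OF st(1)] P(3)[OF st(2)]]
      by (intro norm_triangle_le add_left_mono)
    finally have "norm (P s - P t) * (2 * (1 - q)) \<le> norm (Q s - Q t)"
      by (simp add: algebra_simps)
    then show "dist (P s) (P t) \<le> 1 / (2 * (1 - q)) * dist (Q s) (Q t)"
      using q by (simp add: dist_norm pos_le_divide_eq)
  qed
  then have "continuous_on I (\<lambda>t. id_blinfun - P t)" by (intro continuous_intros)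
  moreover have "cinner ((id_blinfun - P t) z) ((id_blinfun - P t) w) = cinner z w - cinner (T t z) (T t w)"
    if t: "t \<in> I" for t z w
  proof -
    \<comment> \<open>This is P^2 = 2P - Q, hence (1 - P)^2 = 1 - Q.\<close>
    have "P t (P t z) = P t z + P t z - Q t z"
      using arg_cong[OF P2[OF t], of "\<lambda>S. S z"] by (simp add: blinfun.add_left)
    then have "cinner (P t z) (P t w) = cinner (P t z) w + cinner (P t z) w - cinner (Q t z) w"
      using P(2)[OF t] by (metis cinner_add_left cinner_diff_left)
    then show ?thesis
      by (simp add: blinfun.diff_left cinner_diff_left cinner_diff_right blinfun.diff_right
          P(2)[OF t, symmetric] Qw[OF t])
  qed
  moreover have "is_cbounded_op (id_blinfun - P t)" if "t \<in> I" for t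
    using that by (intro is_cbounded_op_diff is_cbounded_op_id P(1))
  ultimately show ?thesis
    by blast
qed

subsection \<open>Dilation to a cyclic shift and its diagonalisation\<close>

primrec blinfun_pow :: "('a::real_normed_vector \<Rightarrow>\<^sub>L 'a) \<Rightarrow> nat \<Rightarrow> ('a \<Rightarrow>\<^sub>L 'a)" where
  "blinfun_pow T 0 = id_blinfun"
| "blinfun_pow T (Suc n) = (T o\<^sub>L blinfun_pow T n)"

lemma blinfun_pow_commute: "blinfun_pow T n (T x) = T (blinfun_pow T n x)"
  by (induction n) auto

lemma norm_blinfun_pow_le:
  assumes "norm T \<le> q" "0 \<le> q"
  shows "norm (blinfun_pow T n x) \<le> q ^ n * norm x"
proof (induction n)
  case (Suc n)
  have "norm (blinfun_pow T (Suc n) x) \<le> norm T * norm (blinfun_pow T n x)" by (simp add: norm_blinfun)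
  also have "\<dots> \<le> q * (q ^ n * norm x)" using assms Suc by (intro mult_mono) auto
  finally show ?case by simp
qed simp

lemma is_cbounded_op_pow: "is_cbounded_op T \<Longrightarrow> is_cbounded_op (blinfun_pow T n)"
  by (induction n) (auto intro: is_cbounded_op_id is_cbounded_op_compose)

lemma continuous_on_blinfun_pow: "continuous_on I T \<Longrightarrow> continuous_on I (\<lambda>t. blinfun_pow (T t) n)"
  by (induction n) (auto intro: continuous_on_blinfun_compose)

definition cscale_op :: "complex \<Rightarrow> 'a::complex_inner \<Rightarrow>\<^sub>L 'a" where
  "cscale_op c = Blinfun (scaleC c)"

lemma cscale_op_apply [simp]: "cscale_op c x = scaleC c x"
  by (simp add: cscale_op_def bounded_linear_Blinfun_apply bounded_linear_scaleC)

lemma is_cbounded_op_cscale: "is_cbounded_op (cscale_op c)"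
  by (simp add: is_cbounded_op_def scaleC_scaleC mult.commute)

text \<open>A geometric sum of powers of an \<open>N\<close>-th root of unity, which equals 1
  exactly when \<open>N\<close> divides \<open>d\<close>: orthogonality of the characters of the
  cyclic group. Integers \<open>d\<close> are allowed because differences of indices occur.\<close>

lemma sum_cis_multiples:
  fixes N :: nat
  assumes "N > 0"
  shows "(\<Sum>k<N. cis (2 * pi * of_int d / N * real k)) = (if int N dvd d then of_nat N else 0)"
proof -
  define x where "x = cis (2 * pi * of_int d / N)"
  have "x ^ k = cis (2 * pi * of_int d / N * real k)" for k
    unfolding x_def Complex.DeMoivre by (rule arg_cong[of _ _ cis]) (rule mult.commute)
  then have s: "(\<Sum>k<N. cis (2 * pi * of_int d / N * real k)) = (\<Sum>k<N. x ^ k)"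
    by simp
  have "real N * (2 * pi * real_of_int d / real N) = 2 * pi * of_int d" using assms by simp
  then have "x ^ N = 1"
    unfolding x_def Complex.DeMoivre by (simp add: cis_multiple_2pi)
  moreover have "x = 1 \<longleftrightarrow> int N dvd d"
  proof
    assume "x = 1"
    then have "cos (2 * pi * of_int d / N) = 1" unfolding x_def by (simp add: complex_eq_iff)
    then obtain m :: int where "2 * pi * of_int d / N = real_of_int m * 2 * pi"
      using cos_one_2pi_int by blast
    then have "real_of_int d = real_of_int (m * int N)" using assms by (simp add: field_simps)
    then have "d = m * int N" by (simp only: of_int_eq_iff)
    then show "int N dvd d" by simp
  next
    assume "int N dvd d"
    then obtain m where "d = int N * m" by blast
    then have "2 * pi * real_of_int d / N = 2 * pi * of_int m" using assms by simp
    then show "x = 1" unfolding x_def by (simp add: cis_multiple_2pi)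
  qed
  ultimately show ?thesis
    unfolding s by (auto simp: sum_gp_strict)
qed

text \<open>\<open>Y\<close> is the discrete Fourier transform of the column \<open>h\<close>.
  Weighting its entries by powers of a root of unity amounts to a cyclic shift by \<open>s\<close>,
  so only pairs with \<open>i\<close> congruent to \<open>j + s\<close> survive. The case s = 0
  yields the isometry property, the case s = 1 the dilated operator.\<close>

lemma sum_cis_cinner_Fourier:
  fixes h :: "nat \<Rightarrow> 'a::complex_inner \<Rightarrow>\<^sub>L 'b::complex_inner" and s :: int and N :: nat
  assumes "N > 0"
  defines "Y \<equiv> \<lambda>k. \<Sum>i<N. cscale_op (cis (- (2 * pi * real i / real N * real k)) / of_real (sqrt N)) o\<^sub>L h i"
  shows "(\<Sum>k<N. cis (2 * pi * of_int s / N * real k) * cinner (Y k z) (Y k w))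
    = (\<Sum>i<N. \<Sum>j<N. if int N dvd s + int j - int i then cinner (h i z) (h j w) else 0)"
proof -
  define c where "c k i = cis (- (2 * pi * real i / real N * real k)) / of_real (sqrt N)" for k i :: nat
  have c: "cis (2 * pi * of_int s / N * real k) * (c k i * cnj (c k j)) = cis (2 * pi * of_int (s + int j - int i) / N * real k) / N"
    for k i j
  proof -
    have "cis (2 * pi * of_int s / N * real k) * (c k i * cnj (c k j)) =
      cis (2 * pi * of_int s / N * k + - (2 * pi * real i / real N * real k) + 2 * pi * real j / N * real k) /
        (of_real (sqrt N) * of_real (sqrt N))"
      unfolding c_def cis_mult[symmetric] by (simp add: cis_cnj)
    also have "of_real (sqrt N) * of_real (sqrt N) = complex_of_real (real N)"
      by (simp flip: of_real_mult)
    also have "2 * pi * of_int s / N * k + - (2 * pi * real i / real N * real k) + 2 * pi * real j / N * real k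
        = 2 * pi * of_int (s + int j - int i) / N * k"
      by (simp add: algebra_simps add_divide_distrib diff_divide_distrib)
    finally show ?thesis by simp
  qed
  have "cinner (Y k z) (Y k w) = (\<Sum>i<N. \<Sum>j<N. (c k i * cnj (c k j)) * cinner (h i z) (h j w))" for k
    unfolding Y_def c_def[symmetric]
    by (simp add: blinfun.sum_left cinner_sum_left cinner_sum_right cinner_scaleC_left cinner_scaleC_right
        sum_distrib_left mult_ac) (rule sum.swap)
  then have "(\<Sum>k<N. cis (2 * pi * of_int s / N * real k) * cinner (Y k z) (Y k w))
    = (\<Sum>k<N. \<Sum>i<N. \<Sum>j<N. cis (2 * pi * of_int s / N * real k) * (c k i * cnj (c k j)) * cinner (h i z) (h j w))"
    by (simp add: sum_distrib_left mult.assoc)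
  also have "\<dots> = (\<Sum>i<N. \<Sum>k<N. \<Sum>j<N. cis (2 * pi * of_int s / N * real k) * (c k i * cnj (c k j)) * cinner (h i z) (h j w))"
    by (rule sum.swap)
  also have "\<dots> = (\<Sum>i<N. \<Sum>j<N. (\<Sum>k<N. cis (2 * pi * of_int (s + int j - int i) / N * real k)) / N * cinner (h i z) (h j w))"
    unfolding c by (subst sum.swap) (simp add: sum_distrib_right sum_divide_distrib)
  also have "\<dots> = (\<Sum>i<N. \<Sum>j<N. if int N dvd s + int j - int i then cinner (h i z) (h j w) else 0)"
    unfolding sum_cis_multiples[OF \<open>N > 0\<close>] using \<open>N > 0\<close> by (intro sum.cong refl) auto
  finally show ?thesis .
qed

lemma dvd_abs_less_imp_eq_0:
  fixes d :: int
  assumes "n dvd d" "\<bar>d\<bar> < n" shows "d = 0"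
proof (rule ccontr)
  assume "d \<noteq> 0"
  from dvd_imp_le_int[OF this assms(1)] assms(2) show False by simp
qed

text \<open>\<open>N\<close> depends on \<open>q\<close> and \<open>\<epsilon>\<close> but not on
  \<open>T\<close>. This uniformity lets the points and the isometries be fixed before the corrected
  targets are known.\<close>

lemma exists_root_of_unity_decomposition:
  fixes I :: "real set"
  assumes sep: "separable_space (euclidean :: 'z::{complex_inner,complete_space} topology)"
    and q: "0 \<le> q" "q < 1" and "\<epsilon> > 0"
  shows "\<exists>N::nat. N > 0 \<and> (\<forall>T :: real \<Rightarrow> 'z \<Rightarrow>\<^sub>L 'z. continuous_on I T \<and> (\<forall>t\<in>I. is_cbounded_op (T t) \<and> norm (T t) \<le> q) \<longrightarrow>
    (\<exists>Y :: nat \<Rightarrow> real \<Rightarrow> 'z \<Rightarrow>\<^sub>L 'z. (\<forall>k. continuous_on I (Y k)) \<and> (\<forall>t\<in>I. (\<forall>k. is_cbounded_op (Y k t)) \<and>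
      (\<forall>z w. (\<Sum>k<N. cinner (Y k t z) (Y k t w)) = cinner z w) \<and>
      (\<forall>z w. cmod ((\<Sum>k<N. cis (2 * pi / real N * real k) * cinner (Y k t z) (Y k t w)) - cinner (T t z) w)
        \<le> \<epsilon> * norm z * norm w))))"
proof -
  \<comment> \<open>Three boundary terms of the shift will remain, each bounded by q^m times the
    norms of \<open>z\<close> and \<open>w\<close>; hence the division by 3.\<close>
  obtain m where m: "q ^ m < \<epsilon> / 3"
    using real_arch_pow_inv[of "\<epsilon> / 3" q] q \<open>\<epsilon> > 0\<close> by auto
  define n where "n = Suc m"
  define N where "N = Suc n"
  have N: "N > 0" by (simp add: N_def)
  have "\<exists>Y :: nat \<Rightarrow> real \<Rightarrow> 'z \<Rightarrow>\<^sub>L 'z. (\<forall>k. continuous_on I (Y k)) \<and> (\<forall>t\<in>I. (\<forall>k. is_cbounded_op (Y k t)) \<and>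
      (\<forall>z w. (\<Sum>k<N. cinner (Y k t z) (Y k t w)) = cinner z w) \<and>
      (\<forall>z w. cmod ((\<Sum>k<N. cis (2 * pi / real N * real k) * cinner (Y k t z) (Y k t w)) - cinner (T t z) w)
        \<le> \<epsilon> * norm z * norm w))"
    if cont: "continuous_on I T" and T: "\<And>t. t \<in> I \<Longrightarrow> is_cbounded_op (T t)" "\<And>t. t \<in> I \<Longrightarrow> norm (T t) \<le> q"
    for T :: "real \<Rightarrow> 'z \<Rightarrow>\<^sub>L 'z"
  proof -
    obtain R :: "real \<Rightarrow> 'z \<Rightarrow>\<^sub>L 'z" where R: "continuous_on I R" "\<And>t. t \<in> I \<Longrightarrow> is_cbounded_op (R t)"
      "\<And>t z w. t \<in> I \<Longrightarrow> cinner (R t z) (R t w) = cinner z w - cinner (T t z) (T t w)"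
      using exists_continuous_defect_operator[OF sep cont T q, simplified] by blast
    \<comment> \<open>The final entry has no factor \<open>R\<close>: it is the remainder of the
      telescoping sum and makes the column isometric.\<close>
    define h where "h i t = (if i < n then R t o\<^sub>L blinfun_pow (T t) i else blinfun_pow (T t) n)" for i t
    define Y where "Y k t = (\<Sum>i<N. cscale_op (cis (- (2 * pi * real i / real N * real k)) / of_real (sqrt N)) o\<^sub>L h i t)" for k t
    have "continuous_on I (h i)" for i
      unfolding h_def by (cases "i < n") (auto intro!: continuous_on_blinfun_compose continuous_on_blinfun_pow R cont)
    then have "continuous_on I (Y k)" for k
      unfolding Y_def by (intro continuous_on_sum continuous_on_blinfun_compose continuous_on_const)
    moreover have "is_cbounded_op (Y k t)" if "t \<in> I" for k t
      unfolding Y_def h_def using that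
      by (auto intro!: is_cbounded_op_sum is_cbounded_op_compose is_cbounded_op_cscale is_cbounded_op_pow T R)
    moreover have "(\<Sum>k<N. cinner (Y k t z) (Y k t w)) = cinner z w \<and>
        cmod ((\<Sum>k<N. cis (2 * pi / real N * real k) * cinner (Y k t z) (Y k t w)) - cinner (T t z) w)
          \<le> \<epsilon> * norm z * norm w" if t: "t \<in> I" for t z w
    proof
      define p where "p i = blinfun_pow (T t) i" for i
      have pT: "p (Suc i) x = T t (p i x)" "p i (T t x) = T t (p i x)" for i x
        by (simp_all add: p_def blinfun_pow_commute)
      have h: "h i t x = R t (p i x)" if "i < n" for i x using that by (simp add: h_def p_def)
      have hn: "h n t x = p n x" for x by (simp add: h_def p_def)
      have RR: "cinner (R t (p i x)) (R t (p i y)) = cinner (p i x) (p i y) - cinner (p (Suc i) x) (p (Suc i) y)" for i x y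
        by (simp add: R(3)[OF t] pT)
      have tele: "(\<Sum>i<k. cinner (R t (p i x)) (R t (p i y))) = cinner x y - cinner (p k x) (p k y)" for k x y
        unfolding RR by (subst sum_lessThan_telescope') (simp add: p_def)
      have "(\<Sum>k<N. cinner (Y k t z) (Y k t w))
          = (\<Sum>i<N. \<Sum>j<N. if int N dvd 0 + int j - int i then cinner (h i t z) (h j t w) else 0)"
        using sum_cis_cinner_Fourier[OF N, of 0 "\<lambda>i. h i t" z w] by (simp add: Y_def)
      also have "\<dots> = (\<Sum>i<N. \<Sum>j<N. if j = i then cinner (h i t z) (h i t w) else 0)"
      proof (intro sum.cong refl)
        fix i j assume ij: "i \<in> {..<N}" "j \<in> {..<N}"
        have "int N dvd 0 + int j - int i \<longleftrightarrow> j = i"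
        proof
          assume "int N dvd 0 + int j - int i"
          moreover have "\<bar>0 + int j - int i\<bar> < int N" using ij by auto
          ultimately have "0 + int j - int i = 0" by (rule dvd_abs_less_imp_eq_0)
          then show "j = i" by simp
        qed simp
        then show "(if int N dvd 0 + int j - int i then cinner (h i t z) (h j t w) else 0)
            = (if j = i then cinner (h i t z) (h i t w) else 0)" by simp
      qed
      also have "\<dots> = (\<Sum>i<n. cinner (R t (p i z)) (R t (p i w))) + cinner (p n z) (p n w)"
        by (simp add: N_def h hn)
      finally show "(\<Sum>k<N. cinner (Y k t z) (Y k t w)) = cinner z w" by (simp add: tele)
      have "(\<Sum>k<N. cis (2 * pi / real N * real k) * cinner (Y k t z) (Y k t w))
          = (\<Sum>i<N. \<Sum>j<N. if int N dvd 1 + int j - int i then cinner (h i t z) (h j t w) else 0)"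
        using sum_cis_cinner_Fourier[OF N, of 1 "\<lambda>i. h i t" z w] by (simp add: Y_def)
      also have "\<dots> = (\<Sum>j<N. \<Sum>i<N. if int N dvd 1 + int j - int i then cinner (h i t z) (h j t w) else 0)"
        by (rule sum.swap)
      \<comment> \<open>Modulo \<open>N = n + 1\<close> each index is paired with its successor, and
        the last index \<open>n\<close> wraps round to 0.\<close>
      also have "\<dots> = (\<Sum>j<N. \<Sum>i<N. if i = (if j = n then 0 else Suc j) then cinner (h i t z) (h j t w) else 0)"
      proof (intro sum.cong refl)
        fix i j assume ij: "i \<in> {..<N}" "j \<in> {..<N}"
        have "int N dvd 1 + int j - int i \<longleftrightarrow> i = (if j = n then 0 else Suc j)"
        proof
          assume d: "int N dvd 1 + int j - int i"
          show "i = (if j = n then 0 else Suc j)"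
          proof (cases "1 + int j - int i = int N")
            case True
            then show ?thesis using ij by (auto simp: N_def)
          next
            case False
            then have "\<bar>1 + int j - int i\<bar> < int N" using ij by auto
            then have "1 + int j - int i = 0" by (rule dvd_abs_less_imp_eq_0[OF d])
            then show ?thesis using ij by (auto simp: N_def)
          qed
        qed (auto simp: N_def)
        then show "(if int N dvd 1 + int j - int i then cinner (h i t z) (h j t w) else 0)
            = (if i = (if j = n then 0 else Suc j) then cinner (h i t z) (h j t w) else 0)" by simp
      qed
      also have "\<dots> = (\<Sum>j<N. cinner (h (if j = n then 0 else Suc j) t z) (h j t w))"
        by (intro sum.cong refl) (subst sum.delta, auto simp: N_def)
      \<comment> \<open>The pairs with \<open>j < m\<close> telescope to the desired inner product
        up to a remainder. The pair with \<open>j = m\<close> meets the final entry without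
        \<open>R\<close>, and the last term is the wrap-around.\<close>
      also have "\<dots> = (\<Sum>j<m. cinner (R t (p j (T t z))) (R t (p j w))) + cinner (p n z) (R t (p m w)) + cinner (R t z) (p n w)"
      proof -
        have "(\<Sum>j<m. cinner (h (if j = n then 0 else Suc j) t z) (h j t w)) = (\<Sum>j<m. cinner (R t (p j (T t z))) (R t (p j w)))"
          by (intro sum.cong refl) (auto simp: n_def h pT)
        moreover have "h 0 t z = R t z" using h[of 0 z] by (simp add: n_def p_def)
        moreover have "h m t w = R t (p m w)" using h[of m w] by (simp add: n_def)
        ultimately show ?thesis using hn by (simp add: N_def n_def)
      qed
      also have "\<dots> - cinner (T t z) w
        = - cinner (p m (T t z)) (p m w) + cinner (p n z) (R t (p m w)) + cinner (R t z) (p n w)"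
        by (simp add: tele)
      finally have eq: "(\<Sum>k<N. cis (2 * pi / real N * real k) * cinner (Y k t z) (Y k t w)) - cinner (T t z) w
        = - cinner (p m (T t z)) (p m w) + cinner (p n z) (R t (p m w)) + cinner (R t z) (p n w)" .
      have nR: "norm (R t x) \<le> norm x" for x
      proof -
        have "complex_of_real ((norm (R t x))\<^sup>2) = of_real ((norm x)\<^sup>2 - (norm (T t x))\<^sup>2)"
          using R(3)[OF t, of x x] by (simp add: cinner_self)
        then have "(norm (R t x))\<^sup>2 = (norm x)\<^sup>2 - (norm (T t x))\<^sup>2" using of_real_eq_iff by blast
        then have "(norm (R t x))\<^sup>2 \<le> (norm x)\<^sup>2" by simp
        then show ?thesis by simp
      qed
      have np: "norm (p i x) \<le> q ^ i * norm x" for i x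
        unfolding p_def by (rule norm_blinfun_pow_le[OF T(2)[OF t] q(1)])
      have np1: "norm (p i x) \<le> norm x" for i x
        using np[of i x] mult_right_mono[OF power_le_one[OF q(1), of i] norm_ge_zero[of x]] q by simp
      have npn: "norm (p n x) \<le> q ^ m * norm x" for x
      proof -
        have "q ^ n \<le> q ^ m" using q by (intro power_decreasing) (auto simp: n_def)
        then show ?thesis using np[of n x] mult_right_mono[of "q ^ n" "q ^ m" "norm x"] by simp
      qed
      have "cmod (- cinner (p m (T t z)) (p m w) + cinner (p n z) (R t (p m w)) + cinner (R t z) (p n w))
        \<le> (q ^ m * norm z) * norm w + (q ^ m * norm z) * norm w + norm z * (q ^ m * norm w)"
      proof (intro norm_triangle_le add_mono)
        have "norm (p m (T t z)) \<le> q ^ m * norm z" using npn[of z] by (simp add: n_def pT)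
        then show "cmod (- cinner (p m (T t z)) (p m w)) \<le> (q ^ m * norm z) * norm w"
          using q unfolding norm_minus_cancel
          by (intro order_trans[OF cinner_Cauchy_Schwarz] mult_mono np1) auto
        show "cmod (cinner (p n z) (R t (p m w))) \<le> (q ^ m * norm z) * norm w"
          using q by (intro order_trans[OF cinner_Cauchy_Schwarz] mult_mono npn order_trans[OF nR np1]) auto
        show "cmod (cinner (R t z) (p n w)) \<le> norm z * (q ^ m * norm w)"
          using q by (intro order_trans[OF cinner_Cauchy_Schwarz] mult_mono npn nR) auto
      qed
      also have "\<dots> = (3 * q ^ m) * norm z * norm w" by simp
      also have "\<dots> \<le> \<epsilon> * norm z * norm w" using m by (intro mult_right_mono) auto
      finally show "cmod ((\<Sum>k<N. cis (2 * pi / real N * real k) * cinner (Y k t z) (Y k t w)) - cinner (T t z) w)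
          \<le> \<epsilon> * norm z * norm w" unfolding eq .
    qed
    ultimately show ?thesis by (intro exI[of _ Y]) blast
  qed
  then show ?thesis using N by blast
qed

subsection \<open>Localisation in time\<close>

lemma sum_div_mod:
  fixes f :: "nat \<Rightarrow> nat \<Rightarrow> 'a::comm_monoid_add"
  assumes "k > 0"
  shows "(\<Sum>a<n * k. f (a div k) (a mod k)) = (\<Sum>i<n. \<Sum>j<k. f i j)"
proof -
  have "(\<Sum>a=i * k..<i * k + k. f (a div k) (a mod k)) = (\<Sum>j<k. f i j)" for i
  proof -
    have "(\<Sum>a=i * k..<i * k + k. f (a div k) (a mod k)) = (\<Sum>a=0 + i * k..<k + i * k. f (a div k) (a mod k))"
      by (simp add: add.commute)
    also have "\<dots> = (\<Sum>j=0..<k. f ((j + i * k) div k) ((j + i * k) mod k))"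
      by (rule sum.shift_bounds_nat_ivl)
    also have "\<dots> = (\<Sum>j<k. f i j)"
      using assms by (intro sum.cong) auto
    finally show ?thesis .
  qed
  then show ?thesis by (simp flip: sum.nat_group)
qed

lemma sum_tent:
  assumes "0 \<le> x" "x \<le> real M"
  shows "(\<Sum>i<Suc M. max 0 (1 - \<bar>x - real i\<bar>)) = 1"
  using assms
proof (induction M)
  case (Suc M)
  show ?case
  proof (cases "x \<le> real M")
    case True
    then show ?thesis using Suc by simp
  next
    case False
    have "(\<Sum>i<M. max 0 (1 - \<bar>x - real i\<bar>)) = 0"
      using False by (intro sum.neutral ballI) auto
    then show ?thesis using False Suc.prems by simp
  qed
qed simp

text \<open>The index \<open>a\<close> encodes a time node \<open>a div N\<close> and a root of
  unity \<open>a mod N\<close>. Dividing \<open>D\<close> by \<open>r\<close> gives strict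
  contractions, which decompose along roots of unity; multiplying back moves the points to the
  circle of radius \<open>r\<close>. As before, \<open>m\<close>, \<open>\<tau>\<close> and
  \<open>\<mu>\<close> are chosen ahead of \<open>D\<close>.\<close>

lemma exists_local_decomposition:
  fixes A :: "real \<Rightarrow> 'h::complex_inner \<Rightarrow>\<^sub>L 'h"
  assumes sep: "separable_space (euclidean :: 'z::{complex_inner,complete_space} topology)"
    and cont: "continuous_on {0..1} A" and \<rho>: "0 \<le> \<rho>" "\<rho> < r" and "\<epsilon> > 0"
  shows "\<exists>m \<tau> \<mu>. m > (0::nat) \<and> (\<forall>a<m. \<tau> a \<in> {0..1} \<and> cmod (\<mu> a) = r) \<and>
    (\<forall>D :: real \<Rightarrow> 'z \<Rightarrow>\<^sub>L 'z. continuous_on {0..1} D \<and> (\<forall>t\<in>{0..1}. is_cbounded_op (D t) \<and> norm (D t) \<le> \<rho>) \<longrightarrow>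
      (\<exists>B :: nat \<Rightarrow> real \<Rightarrow> 'z \<Rightarrow>\<^sub>L 'z. (\<forall>a. continuous_on {0..1} (B a)) \<and> (\<forall>t\<in>{0..1}. (\<forall>a. is_cbounded_op (B a t)) \<and>
        (\<forall>z w. (\<Sum>a<m. cinner (B a t z) (B a t w)) = cinner z w) \<and>
        (\<forall>z w. cmod ((\<Sum>a<m. \<mu> a * cinner (B a t z) (B a t w)) - cinner (D t z) w) \<le> \<epsilon> * norm z * norm w) \<and>
        (\<forall>a. B a t \<noteq> 0 \<longrightarrow> norm (A t - A (\<tau> a)) \<le> \<epsilon>))))"
proof -
  have r: "r > 0" using \<rho> by simp
  have q: "0 \<le> \<rho> / r" "\<rho> / r < 1" "\<epsilon> / r > 0" using \<rho> r \<open>\<epsilon> > 0\<close> by auto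
  obtain N where N: "(N::nat) > 0" and Y: "\<forall>T :: real \<Rightarrow> 'z \<Rightarrow>\<^sub>L 'z. continuous_on {0..1} T \<and>
      (\<forall>t\<in>{0..1}. is_cbounded_op (T t) \<and> norm (T t) \<le> \<rho> / r) \<longrightarrow>
    (\<exists>Y :: nat \<Rightarrow> real \<Rightarrow> 'z \<Rightarrow>\<^sub>L 'z. (\<forall>k. continuous_on {0..1} (Y k)) \<and> (\<forall>t\<in>{0..1}. (\<forall>k. is_cbounded_op (Y k t)) \<and>
      (\<forall>z w. (\<Sum>k<N. cinner (Y k t z) (Y k t w)) = cinner z w) \<and>
      (\<forall>z w. cmod ((\<Sum>k<N. cis (2 * pi / real N * real k) * cinner (Y k t z) (Y k t w)) - cinner (T t z) w)
        \<le> \<epsilon> / r * norm z * norm w)))"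
    using exists_root_of_unity_decomposition[OF sep q, of "{0..1}"] by blast
  have "uniformly_continuous_on {0..1} A" using cont by (intro compact_uniformly_continuous) auto
  then have "\<exists>d>0. \<forall>s\<in>{0..1}. \<forall>t\<in>{0..1}. dist t s < d \<longrightarrow> dist (A t) (A s) < \<epsilon>"
    using \<open>\<epsilon> > 0\<close> unfolding uniformly_continuous_on_def by simp
  then obtain d where d: "d > 0" "\<And>s t. s \<in> {0..1} \<Longrightarrow> t \<in> {0..1} \<Longrightarrow> dist t s < d \<Longrightarrow> dist (A t) (A s) < \<epsilon>"
    by blast
  obtain M where M: "inverse (real (Suc M)) < d" using reals_Archimedean[OF d(1)] by blast
  \<comment> \<open>The nodes are i / K for i = 0, ..., K, so there are \<open>Suc K\<close> of
    them, and their spacing lies below \<open>d\<close>.\<close>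
  define K where "K = Suc M"
  define m where "m = Suc K * N"
  \<comment> \<open>The minimum takes effect only for \<open>a\<close> at least \<open>m\<close>; it
    keeps every \<open>\<tau> a\<close> in the unit interval.\<close>
  define \<tau> where "\<tau> a = min 1 (real (a div N) / real K)" for a
  define \<mu> where "\<mu> a = of_real r * cis (2 * pi / real N * real (a mod N))" for a
  \<comment> \<open>Square roots of tent functions, since each \<open>B a\<close> enters
    quadratically and the squares must sum to 1.\<close>
  define \<phi> where "\<phi> i t = sqrt (max 0 (1 - \<bar>real K * t - real i\<bar>))" for i t
  have \<phi>2: "(\<phi> i t)\<^sup>2 = max 0 (1 - \<bar>real K * t - real i\<bar>)" for i t
    unfolding \<phi>_def by (rule real_sqrt_pow2) simp
  have \<phi>sum: "(\<Sum>i<Suc K. (\<phi> i t)\<^sup>2) = 1" if "t \<in> {0..1}" for t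
    unfolding \<phi>2 using that by (intro sum_tent) (auto simp: mult_left_le)
  have \<phi>near: "norm (A t - A (\<tau> a)) \<le> \<epsilon>" if t: "t \<in> {0..1}" and nz: "\<phi> (a div N) t \<noteq> 0" for a t
  proof -
    have "max 0 (1 - \<bar>real K * t - real (a div N)\<bar>) \<noteq> 0"
      using nz unfolding \<phi>_def by simp
    then have "\<bar>real K * t - real (a div N)\<bar> < 1" by (simp add: max_def split: if_splits)
    moreover have "real K * t - real (a div N) = real K * (t - real (a div N) / real K)"
      by (simp add: K_def field_simps)
    ultimately have "real K * \<bar>t - real (a div N) / real K\<bar> < 1" by (simp add: abs_mult)
    then have "\<bar>t - real (a div N) / real K\<bar> < inverse (real K)"
      by (simp add: K_def field_simps)
    then have "\<bar>t - \<tau> a\<bar> < inverse (real K)" using t by (auto simp: \<tau>_def min_def)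
    then have "dist t (\<tau> a) < d" using M by (simp add: dist_real_def K_def)
    moreover have "\<tau> a \<in> {0..1}" by (simp add: \<tau>_def)
    ultimately show ?thesis using d(2)[OF _ t, of "\<tau> a"] by (simp add: dist_norm)
  qed
  have "\<exists>B :: nat \<Rightarrow> real \<Rightarrow> 'z \<Rightarrow>\<^sub>L 'z. (\<forall>a. continuous_on {0..1} (B a)) \<and> (\<forall>t\<in>{0..1}. (\<forall>a. is_cbounded_op (B a t)) \<and>
        (\<forall>z w. (\<Sum>a<m. cinner (B a t z) (B a t w)) = cinner z w) \<and>
        (\<forall>z w. cmod ((\<Sum>a<m. \<mu> a * cinner (B a t z) (B a t w)) - cinner (D t z) w) \<le> \<epsilon> * norm z * norm w) \<and>
        (\<forall>a. B a t \<noteq> 0 \<longrightarrow> norm (A t - A (\<tau> a)) \<le> \<epsilon>))"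
    if D: "continuous_on {0..1} D" "\<forall>t\<in>{0..1}. is_cbounded_op (D t) \<and> norm (D t) \<le> \<rho>" for D :: "real \<Rightarrow> 'z \<Rightarrow>\<^sub>L 'z"
  proof -
    have "continuous_on {0..1} (\<lambda>t. (1 / r) *\<^sub>R D t)" by (intro continuous_intros D)
    moreover have "\<forall>t\<in>{0..1}. is_cbounded_op ((1 / r) *\<^sub>R D t) \<and> norm ((1 / r) *\<^sub>R D t) \<le> \<rho> / r"
      using D(2) r by (auto intro!: is_cbounded_op_scaleR divide_right_mono)
    ultimately obtain Y :: "nat \<Rightarrow> real \<Rightarrow> 'z \<Rightarrow>\<^sub>L 'z" where Yc: "\<And>k. continuous_on {0..1} (Y k)"
      and Ycb: "\<And>t k. t \<in> {0..1} \<Longrightarrow> is_cbounded_op (Y k t)"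
      and Yi: "\<And>t z w. t \<in> {0..1} \<Longrightarrow> (\<Sum>k<N. cinner (Y k t z) (Y k t w)) = cinner z w"
      and Yd: "\<And>t z w. t \<in> {0..1} \<Longrightarrow> cmod ((\<Sum>k<N. cis (2 * pi / real N * real k) * cinner (Y k t z) (Y k t w))
          - cinner (((1 / r) *\<^sub>R D t) z) w) \<le> \<epsilon> / r * norm z * norm w"
      using Y[rule_format, of "\<lambda>t. (1 / r) *\<^sub>R D t"] by blast
    define B where "B a t = \<phi> (a div N) t *\<^sub>R Y (a mod N) t" for a t
    have "continuous_on {0..1} (B a)" for a
      unfolding B_def \<phi>_def by (intro continuous_intros Yc)
    moreover have "is_cbounded_op (B a t)" if "t \<in> {0..1}" for a t
      unfolding B_def by (intro is_cbounded_op_scaleR Ycb that)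
    \<comment> \<open>Weights that depend on the root index alone separate from the sum over the
      time nodes, which is 1. Constant weights give the isometry property, the points
      \<open>\<mu>\<close> give the target.\<close>
    moreover have Bsum: "(\<Sum>a<m. g (a mod N) * cinner (B a t z) (B a t w)) = (\<Sum>k<N. g k * cinner (Y k t z) (Y k t w))"
      if t: "t \<in> {0..1}" for g t z w
    proof -
      have "(\<Sum>a<m. g (a mod N) * cinner (B a t z) (B a t w))
          = (\<Sum>a<m. of_real ((\<phi> (a div N) t)\<^sup>2) * (g (a mod N) * cinner (Y (a mod N) t z) (Y (a mod N) t w)))"
        by (simp add: B_def blinfun.scaleR_left cinner_scaleR_left cinner_scaleR_right scaleR_conv_of_real
            power2_eq_square mult_ac)
      also have "\<dots> = (\<Sum>i<Suc K. \<Sum>k<N. of_real ((\<phi> i t)\<^sup>2) * (g k * cinner (Y k t z) (Y k t w)))"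
        unfolding m_def by (rule sum_div_mod[OF N])
      also have "\<dots> = of_real (\<Sum>i<Suc K. (\<phi> i t)\<^sup>2) * (\<Sum>k<N. g k * cinner (Y k t z) (Y k t w))"
        unfolding of_real_sum by (rule sum_product[symmetric])
      finally show ?thesis by (simp only: \<phi>sum[OF t] of_real_1 mult_1)
    qed
    moreover have "(\<Sum>a<m. cinner (B a t z) (B a t w)) = cinner z w" if t: "t \<in> {0..1}" for t z w
      using Bsum[OF t, of "\<lambda>_. 1" z w] Yi[OF t, of z w] by simp
    moreover have "cmod ((\<Sum>a<m. \<mu> a * cinner (B a t z) (B a t w)) - cinner (D t z) w) \<le> \<epsilon> * norm z * norm w"
      if t: "t \<in> {0..1}" for t z w
    proof -
      have "(\<Sum>a<m. \<mu> a * cinner (B a t z) (B a t w)) - cinner (D t z) w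
        = of_real r * ((\<Sum>k<N. cis (2 * pi / real N * real k) * cinner (Y k t z) (Y k t w)) - cinner (((1 / r) *\<^sub>R D t) z) w)"
        using Bsum[OF t, of "\<lambda>k. of_real r * cis (2 * pi / real N * real k)" z w] r
        by (simp add: \<mu>_def sum_distrib_left right_diff_distrib blinfun.scaleR_left cinner_scaleR_left
            scaleR_conv_of_real mult.assoc)
      then have "cmod ((\<Sum>a<m. \<mu> a * cinner (B a t z) (B a t w)) - cinner (D t z) w)
        \<le> r * (\<epsilon> / r * norm z * norm w)"
        using mult_left_mono[OF Yd[OF t, of z w], of r] r by (simp only: norm_mult norm_of_real abs_of_pos less_imp_le)
      then show ?thesis using r by simp
    qed
    moreover have "norm (A t - A (\<tau> a)) \<le> \<epsilon>" if "t \<in> {0..1}" "B a t \<noteq> 0" for a t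
      using that by (intro \<phi>near) (auto simp: B_def)
    ultimately show ?thesis by (intro exI[of _ B]) blast
  qed
  moreover have "\<forall>a<m. \<tau> a \<in> {0..1} \<and> cmod (\<mu> a) = r"
    using r by (simp add: \<tau>_def \<mu>_def norm_mult)
  moreover have "m > 0" using N by (simp add: m_def)
  ultimately show ?thesis by (intro exI[of _ m] exI[of _ \<tau>] exI[of _ \<mu>]) blast
qed

text \<open>Off the diagonal the geometric weights are summed absolutely. On the diagonal,
  Cauchy-Schwarz together with the isometry of the column bounds the total by
  \<open>\<kappa>\<close> without a factor \<open>m\<close>. The condition
  \<open>B a \<noteq> 0\<close> makes room for localisation: only the active time nodes need a good
  diagonal.\<close>

lemma compression_estimate:
  fixes A :: "'h::complex_inner \<Rightarrow>\<^sub>L 'h" and U :: "nat \<Rightarrow> 'z::complex_inner \<Rightarrow>\<^sub>L 'h" and B :: "nat \<Rightarrow> 'z \<Rightarrow>\<^sub>L 'z"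
  assumes iso: "\<And>z w. (\<Sum>a<m. cinner (B a z) (B a w)) = cinner z w"
    and off: "\<And>a b z w. a \<noteq> b \<Longrightarrow> cmod (cinner (A (U a z)) (U b w)) \<le> \<eta> * (1/4)^a * (1/4)^b * norm z * norm w"
    and diag: "\<And>a z w. a < m \<Longrightarrow> B a \<noteq> 0 \<Longrightarrow> cmod (cinner (A (U a z)) (U a w) - \<mu> a * cinner z w) \<le> \<kappa> * norm z * norm w"
    and "\<eta> \<ge> 0" "\<kappa> \<ge> 0"
  defines "X \<equiv> \<Sum>a<m. U a o\<^sub>L B a"
  shows "cmod (cinner (A (X z)) (X w) - (\<Sum>a<m. \<mu> a * cinner (B a z) (B a w))) \<le> (2 * \<eta> + \<kappa>) * norm z * norm w"
proof -
  have sq: "(\<Sum>a<m. (norm (B a x))\<^sup>2) = (norm x)\<^sup>2" for x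
  proof -
    have "complex_of_real (\<Sum>a<m. (norm (B a x))\<^sup>2) = of_real ((norm x)\<^sup>2)"
      using iso[of x x] by (simp add: cinner_self)
    then show ?thesis using of_real_eq_iff by blast
  qed
  have nB: "norm (B a x) \<le> norm x" if "a < m" for a x
  proof -
    have "(norm (B a x))\<^sup>2 \<le> (\<Sum>a<m. (norm (B a x))\<^sup>2)"
      using that by (intro member_le_sum) auto
    then show ?thesis unfolding sq by simp
  qed
  have "(\<Sum>a<m. norm (B a z) * norm (B a w)) \<le> sqrt (\<Sum>a<m. (norm (B a z))\<^sup>2) * sqrt (\<Sum>a<m. (norm (B a w))\<^sup>2)"
    using L2_set_mult_ineq[of "\<lambda>a. norm (B a z)" "\<lambda>a. norm (B a w)" "{..<m}"]
    by (simp add: L2_set_def)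
  then have CS: "(\<Sum>a<m. norm (B a z) * norm (B a w)) \<le> norm z * norm w" by (simp add: sq)
  define E where "E a b = cinner (A (U a (B a z))) (U b (B b w)) - (if b = a then \<mu> a * cinner (B a z) (B a w) else 0)" for a b
  have "cmod (E a b) \<le> norm z * norm w * \<eta> * ((1/4)^a * (1/4)^b) + (if b = a then \<kappa> * (norm (B a z) * norm (B a w)) else 0)"
    if "a < m" "b < m" for a b
  proof (cases "b = a")
    case True
    have "cmod (E a a) \<le> \<kappa> * norm (B a z) * norm (B a w)"
    proof (cases "B a = 0")
      case False
      then show ?thesis using diag[OF that(1) False, of "B a z" "B a w"] by (simp add: E_def)
    qed (simp add: E_def)
    moreover have "0 \<le> norm z * norm w * \<eta> * ((1/4)^a * (1/4)^a)" using \<open>\<eta> \<ge> 0\<close> by simp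
    ultimately show ?thesis unfolding True by (simp add: mult.assoc)
  next
    case False
    then have "cmod (E a b) \<le> \<eta> * (1/4)^a * (1/4)^b * norm (B a z) * norm (B b w)"
      using off[of a b "B a z" "B b w"] by (simp add: E_def)
    also have "\<dots> \<le> \<eta> * (1/4)^a * (1/4)^b * norm z * norm w"
      using that \<open>\<eta> \<ge> 0\<close> by (intro mult_mono nB) auto
    finally show ?thesis using False by (simp add: mult_ac)
  qed
  then have "cmod (\<Sum>a<m. \<Sum>b<m. E a b) \<le> (\<Sum>a<m. \<Sum>b<m. norm z * norm w * \<eta> * ((1/4)^a * (1/4)^b)
      + (if b = a then \<kappa> * (norm (B a z) * norm (B a w)) else 0))"
    by (intro order_trans[OF norm_sum] sum_mono) auto
  also have "\<dots> = norm z * norm w * \<eta> * ((\<Sum>a<m. (1/4)^a) * (\<Sum>b<m. (1/4)^b)) + \<kappa> * (\<Sum>a<m. norm (B a z) * norm (B a w))"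
    unfolding sum_product by (simp add: sum.distrib sum_distrib_left)
  also have "\<dots> \<le> norm z * norm w * \<eta> * ((4/3) * (4/3)) + \<kappa> * (norm z * norm w)"
    using \<open>\<eta> \<ge> 0\<close> \<open>\<kappa> \<ge> 0\<close> CS
    by (intro add_mono mult_left_mono mult_mono sum_quarter_powers_le) (auto intro: sum_nonneg)
  also have "\<dots> \<le> norm z * norm w * \<eta> * 2 + \<kappa> * (norm z * norm w)"
    using \<open>\<eta> \<ge> 0\<close> by (intro add_right_mono mult_left_mono) auto
  also have "\<dots> = (2 * \<eta> + \<kappa>) * norm z * norm w" by (simp add: algebra_simps)
  also have "(\<Sum>a<m. \<Sum>b<m. E a b) = cinner (A (X z)) (X w) - (\<Sum>a<m. \<mu> a * cinner (B a z) (B a w))"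
    unfolding E_def X_def
    by (simp add: sum_subtractf blinfun.sum_left blinfun.sum_right cinner_sum_left cinner_sum_right) (rule sum.swap)
  finally show ?thesis .
qed

subsection \<open>Exact compressions\<close>

text \<open>The residual after \<open>l\<close> terms is kept below
  \<open>(c l)\<^sup>2 * \<delta>\<close>. Divided by \<open>(c l)\<^sup>2\<close> it moves the
  target by at most \<open>\<delta>\<close>, so the target stays within reach, and one more term
  shrinks the bound by the factor 4, just as \<open>(c l)\<^sup>2\<close> shrinks. In the limit the
  residual vanishes.\<close>

lemma exists_exact_compression:
  fixes A :: "real \<Rightarrow> 'h::{complex_inner,complete_space} \<Rightarrow>\<^sub>L 'h"
    and D :: "real \<Rightarrow> 'z::{complex_inner,complete_space} \<Rightarrow>\<^sub>L 'z"
  assumes sep: "separable_space (euclidean :: 'z topology)"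
    and Acont: "continuous_on {0..1} A" and Acb: "\<And>t. t \<in> {0..1} \<Longrightarrow> is_cbounded_op (A t)"
    and Dcont: "continuous_on {0..1} D" and Dcb: "\<And>t. t \<in> {0..1} \<Longrightarrow> is_cbounded_op (D t)"
    and Dn: "\<And>t. t \<in> {0..1} \<Longrightarrow> norm (D t) \<le> \<rho>" and "\<rho> < r"
    and W: "\<And>t x. t \<in> {0..1} \<Longrightarrow> cmod x < r \<Longrightarrow> x \<in> ess_num_range (A t)"
  shows "\<exists>S :: real \<Rightarrow> 'z \<Rightarrow>\<^sub>L 'h. continuous_on {0..1} S \<and> (\<forall>t\<in>{0..1}. is_cbounded_op (S t) \<and>
    (\<forall>z w. cinner (S t z) (S t w) = cinner z w) \<and>
    (\<forall>z w. cinner (A t (S t z)) (S t w) = cinner (D t z) w))"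
proof -
  have "0 \<le> \<rho>" using Dn[of 0] order_trans[OF norm_ge_zero] by auto
  \<comment> \<open>One third of the gap pays for correcting the targets, one third keeps them
    strictly inside the circle of the points, and one third keeps that circle strictly inside the
    disc of radius \<open>r\<close>.\<close>
  define \<delta> where "\<delta> = (r - \<rho>) / 3"
  have \<delta>: "\<delta> > 0" using \<open>\<rho> < r\<close> by (simp add: \<delta>_def)
  have "\<rho> + 2 * \<delta> < r" using \<open>\<rho> < r\<close> by (simp add: \<delta>_def field_simps)
  \<comment> \<open>The constants ensure that 9 \<open>\<eta>\<close> + 2 \<open>\<epsilon>\<close>
    is at most \<open>\<delta> / 4\<close>, which is what the new residual requires.\<close>
  define \<epsilon> where "\<epsilon> = \<delta> / 32"
  define \<eta> where "\<eta> = \<delta> / 128"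
  have \<epsilon>: "\<epsilon> > 0" and \<eta>: "\<eta> > 0" using \<delta> by (auto simp: \<epsilon>_def \<eta>_def)
  have "0 \<le> \<rho> + \<delta>" "\<rho> + \<delta> < \<rho> + 2 * \<delta>" using \<open>0 \<le> \<rho>\<close> \<delta> by auto
  from exists_local_decomposition[OF sep Acont this \<epsilon>]
  obtain m \<tau> \<mu> where m: "m > (0::nat)" and \<tau>: "\<And>a. a < m \<Longrightarrow> \<tau> a \<in> {0..1}"
    and \<mu>: "\<And>a. a < m \<Longrightarrow> cmod (\<mu> a) = \<rho> + 2 * \<delta>"
    and dec: "\<forall>D' :: real \<Rightarrow> 'z \<Rightarrow>\<^sub>L 'z. continuous_on {0..1} D' \<and> (\<forall>t\<in>{0..1}. is_cbounded_op (D' t) \<and> norm (D' t) \<le> \<rho> + \<delta>) \<longrightarrow>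
      (\<exists>B :: nat \<Rightarrow> real \<Rightarrow> 'z \<Rightarrow>\<^sub>L 'z. (\<forall>a. continuous_on {0..1} (B a)) \<and> (\<forall>t\<in>{0..1}. (\<forall>a. is_cbounded_op (B a t)) \<and>
        (\<forall>z w. (\<Sum>a<m. cinner (B a t z) (B a t w)) = cinner z w) \<and>
        (\<forall>z w. cmod ((\<Sum>a<m. \<mu> a * cinner (B a t z) (B a t w)) - cinner (D' t z) w) \<le> \<epsilon> * norm z * norm w) \<and>
        (\<forall>a. B a t \<noteq> 0 \<longrightarrow> norm (A t - A (\<tau> a)) \<le> \<epsilon>)))"
    by blast
  define adm where "adm D' \<longleftrightarrow> continuous_on {0..1} D' \<and> (\<forall>t\<in>{0..1}. is_cbounded_op (D' t) \<and> norm (D' t) \<le> \<rho> + \<delta>)"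
    for D' :: "real \<Rightarrow> 'z \<Rightarrow>\<^sub>L 'z"
  define good where "good D' B \<longleftrightarrow> (\<forall>a. continuous_on {0..1} (B a)) \<and> (\<forall>t\<in>{0..1}. (\<forall>a. is_cbounded_op (B a t)) \<and>
        (\<forall>z w. (\<Sum>a<m. cinner (B a t z) (B a t w)) = cinner z w) \<and>
        (\<forall>z w. cmod ((\<Sum>a<m. \<mu> a * cinner (B a t z) (B a t w)) - cinner (D' t z) w) \<le> \<epsilon> * norm z * norm w) \<and>
        (\<forall>a. B a t \<noteq> 0 \<longrightarrow> norm (A t - A (\<tau> a)) \<le> \<epsilon>))"
    for D' :: "real \<Rightarrow> 'z \<Rightarrow>\<^sub>L 'z" and B :: "nat \<Rightarrow> real \<Rightarrow> 'z \<Rightarrow>\<^sub>L 'z"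
  \<comment> \<open>A choice function on all targets is needed, since the target of each level
    depends on the operators built before it.\<close>
  have "\<forall>D'. \<exists>B. adm D' \<longrightarrow> good D' B"
    using dec unfolding adm_def good_def by blast
  then obtain BB where BB: "\<And>D'. adm D' \<Longrightarrow> good D' (BB D')"
    using choice[of "\<lambda>D' B. adm D' \<longrightarrow> good D' B"] by blast
  \<comment> \<open>The \<open>m\<close> pairs of time and point are repeated periodically, so that
    every level \<open>l\<close> has a fresh block of isometries \<open>U (l * m + a)\<close>
    realising all of them.\<close>
  have "\<exists>U :: nat \<Rightarrow> 'z \<Rightarrow>\<^sub>L 'h. (\<forall>y. is_cbounded_op (U y)) \<and>
    (\<forall>y y' z w. cinner (U y z) (U y' w) = (if y = y' then cinner z w else 0)) \<and>
    (\<forall>t\<in>{0..1}. \<forall>y y' z w. y \<noteq> y' \<longrightarrow>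
      cmod (cinner (A t (U y z)) (U y' w)) \<le> \<eta> * (1/4)^y * (1/4)^y' * norm z * norm w) \<and>
    (\<forall>y z w. cmod (cinner (A (\<tau> (y mod m)) (U y z)) (U y w) - \<mu> (y mod m) * cinner z w) \<le> \<eta> * norm z * norm w)"
  proof (intro exists_isometry_family sep Acont Acb \<eta>)
    fix y
    have "y mod m < m" using m by simp
    then show "\<tau> (y mod m) \<in> {0..1}" by (rule \<tau>)
    show "\<mu> (y mod m) \<in> ess_num_range (A (\<tau> (y mod m)))"
      using \<open>\<rho> + 2 * \<delta> < r\<close> \<mu>[OF \<open>y mod m < m\<close>] by (intro W \<tau> \<open>y mod m < m\<close>) simp
  qed
  then obtain U :: "nat \<Rightarrow> 'z \<Rightarrow>\<^sub>L 'h" where U: "\<forall>y. is_cbounded_op (U y)"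
    "\<forall>y y' z w. cinner (U y z) (U y' w) = (if y = y' then cinner z w else 0)"
    "\<forall>t\<in>{0..1}. \<forall>y y' z w. y \<noteq> y' \<longrightarrow>
      cmod (cinner (A t (U y z)) (U y' w)) \<le> \<eta> * (1/4)^y * (1/4)^y' * norm z * norm w"
    "\<forall>y z w. cmod (cinner (A (\<tau> (y mod m)) (U y z)) (U y w) - \<mu> (y mod m) * cinner z w) \<le> \<eta> * norm z * norm w"
    by (elim exE conjE) (rule that; assumption)
  have Ucb: "is_cbounded_op (U y)" for y using U(1) ..
  have UU: "cinner (U y z) (U y' w) = (if y = y' then cinner z w else 0)" for y y' z w
    using U(2) by simp
  have Uoff: "cmod (cinner (A t (U y z)) (U y' w)) \<le> \<eta> * (1/4)^y * (1/4)^y' * norm z * norm w"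
    if "t \<in> {0..1}" "y \<noteq> y'" for t y y' z w
    using U(3) that by blast
  have Udiag: "cmod (cinner (A (\<tau> (y mod m)) (U y z)) (U y w) - \<mu> (y mod m) * cinner z w) \<le> \<eta> * norm z * norm w" for y z w
    using U(4) by blast
  \<comment> \<open>The squares of \<open>c\<close> form a geometric series of ratio 1/4 and sum 1,
    and \<open>s l\<close> is the sum of the first \<open>l\<close> of them.\<close>
  define c where "c l = sqrt (3/4) * (1/2)^l" for l :: nat
  define s where "s l = 1 - (1/4::real)^l" for l :: nat
  have c2: "(c l)\<^sup>2 = 3/4 * (1/4)^l" for l
  proof -
    have "((1/2::real)^l)\<^sup>2 = (1/4)^l" by (simp add: power2_eq_square flip: power_mult_distrib)
    then show ?thesis by (simp add: c_def power_mult_distrib)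
  qed
  have c0: "c l > 0" for l by (simp add: c_def)
  have cle: "c l \<le> (1/2)^l" for l by (simp add: c_def mult_left_le_one_le real_le_lsqrt)
  have c1: "c l \<le> 1" for l using cle[of l] power_le_one[of "1/2::real" l] by simp
  have s_Suc: "s (Suc l) = s l + (c l)\<^sup>2" for l by (simp add: c2 s_def)
  have c_Suc: "(c (Suc l))\<^sup>2 = (c l)\<^sup>2 / 4" for l by (simp add: c2)
  \<comment> \<open>\<open>E l Q\<close> is the corrected target of level \<open>l\<close> when \<open>Q\<close> is the sum of the previous terms.\<close>
  define E where "E l Q t = (1 / (c l)\<^sup>2) *\<^sub>R (s (Suc l) *\<^sub>R D t - (adj (Q t) o\<^sub>L (A t o\<^sub>L Q t)))"
    for l and Q :: "real \<Rightarrow> 'z \<Rightarrow>\<^sub>L 'h" and t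
  define X where "X l Q t = (\<Sum>a<m. U (l * m + a) o\<^sub>L BB (E l Q) a t)" for l Q t
  define K where "K l = (\<Sum>y<l * m. (1/4::real)^y)" for l
  have K0: "K l \<ge> 0" and K43: "K l \<le> 4/3" for l
    unfolding K_def by (rule sum_nonneg, simp) (rule sum_quarter_powers_le)
  define Inv where "Inv l Q \<longleftrightarrow> continuous_on {0..1} Q \<and> (\<forall>t\<in>{0..1}. is_cbounded_op (Q t) \<and>
      (\<forall>z w. cinner (Q t z) (Q t w) = of_real (s l) * cinner z w) \<and>
      (\<forall>y\<ge>l * m. \<forall>z w. cinner (Q t z) (U y w) = 0) \<and>
      (\<forall>y\<ge>l * m. \<forall>z w. cmod (cinner (A t (Q t z)) (U y w)) \<le> \<eta> * K l * (1/4)^y * norm z * norm w \<and>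
        cmod (cinner (A t (U y z)) (Q t w)) \<le> \<eta> * K l * (1/4)^y * norm z * norm w) \<and>
      (\<forall>z w. cmod (of_real (s l) * cinner (D t z) w - cinner (A t (Q t z)) (Q t w)) \<le> (c l)\<^sup>2 * \<delta> * norm z * norm w))"
    for l and Q :: "real \<Rightarrow> 'z \<Rightarrow>\<^sub>L 'h"
  have step: "Inv (Suc l) (\<lambda>t. Q t + c l *\<^sub>R X l Q t) \<and> (\<forall>t\<in>{0..1}. norm (X l Q t) \<le> 1)" if Q: "Inv l Q" for l Q
  proof -
    have Qc: "continuous_on {0..1} Q" and Qcb: "\<And>t. t \<in> {0..1} \<Longrightarrow> is_cbounded_op (Q t)"
      and QQ: "\<And>t z w. t \<in> {0..1} \<Longrightarrow> cinner (Q t z) (Q t w) = of_real (s l) * cinner z w"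
      and QU: "\<And>t y z w. t \<in> {0..1} \<Longrightarrow> y \<ge> l * m \<Longrightarrow> cinner (Q t z) (U y w) = 0"
      and AQU: "\<And>t y z w. t \<in> {0..1} \<Longrightarrow> y \<ge> l * m \<Longrightarrow> cmod (cinner (A t (Q t z)) (U y w)) \<le> \<eta> * K l * (1/4)^y * norm z * norm w"
      and AUQ: "\<And>t y z w. t \<in> {0..1} \<Longrightarrow> y \<ge> l * m \<Longrightarrow> cmod (cinner (A t (U y z)) (Q t w)) \<le> \<eta> * K l * (1/4)^y * norm z * norm w"
      and res: "\<And>t z w. t \<in> {0..1} \<Longrightarrow> cmod (of_real (s l) * cinner (D t z) w - cinner (A t (Q t z)) (Q t w)) \<le> (c l)\<^sup>2 * \<delta> * norm z * norm w"
      using Q unfolding Inv_def by auto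
    have cE: "of_real ((c l)\<^sup>2) * cinner (E l Q t z) w = of_real (s (Suc l)) * cinner (D t z) w - cinner (A t (Q t z)) (Q t w)"
      if "t \<in> {0..1}" for t z w
      using c0[of l] cinner_adj_left[OF sep Qcb[OF that]]
      by (simp add: E_def blinfun.scaleR_left blinfun.diff_left cinner_scaleR_left cinner_diff_left scaleR_conv_of_real)
    have "adm (E l Q)"
      unfolding adm_def
    proof (intro conjI ballI)
      show "continuous_on {0..1} (E l Q)"
        unfolding E_def[abs_def]
        by (intro continuous_on_scaleR continuous_on_const continuous_on_diff continuous_on_blinfun_compose
            continuous_on_adj sep Qc Qcb Acont Dcont)
    next
      fix t :: real assume t: "t \<in> {0..1}"
      show "is_cbounded_op (E l Q t)"
        unfolding E_def by (intro is_cbounded_op_scaleR is_cbounded_op_diff is_cbounded_op_compose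
            is_cbounded_op_adj sep Qcb Acb Dcb t)
      show "norm (E l Q t) \<le> \<rho> + \<delta>"
      proof (rule norm_blinfun_le_of_cinner)
        fix z w
        \<comment> \<open>Since \<open>s (Suc l) = s l + (c l)\<^sup>2\<close>, the corrected target
          is \<open>D\<close> plus the old residual divided by \<open>(c l)\<^sup>2\<close>.\<close>
        have "of_real ((c l)\<^sup>2) * cinner (E l Q t z) w = of_real ((c l)\<^sup>2) * cinner (D t z) w +
            (of_real (s l) * cinner (D t z) w - cinner (A t (Q t z)) (Q t w))"
          unfolding cE[OF t] s_Suc by (simp add: distrib_right)
        also have "cmod \<dots> \<le> (c l)\<^sup>2 * (\<rho> * norm z * norm w) + (c l)\<^sup>2 * \<delta> * norm z * norm w"
        proof (intro norm_triangle_le add_mono res t)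
          have "cmod (cinner (D t z) w) \<le> norm (D t z) * norm w" by (rule cinner_Cauchy_Schwarz)
          also have "\<dots> \<le> \<rho> * norm z * norm w"
            using order_trans[OF norm_blinfun mult_right_mono[OF Dn[OF t] norm_ge_zero]]
            by (intro mult_right_mono) auto
          finally show "cmod (of_real ((c l)\<^sup>2) * cinner (D t z) w) \<le> (c l)\<^sup>2 * (\<rho> * norm z * norm w)"
            unfolding norm_mult norm_of_real by (simp add: mult_left_mono)
        qed
        also have "\<dots> = (c l)\<^sup>2 * ((\<rho> + \<delta>) * norm z * norm w)" by (simp add: algebra_simps)
        finally have "(c l)\<^sup>2 * cmod (cinner (E l Q t z) w) \<le> (c l)\<^sup>2 * ((\<rho> + \<delta>) * norm z * norm w)"
          by (simp add: norm_mult norm_power)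
        then show "cmod (cinner (E l Q t z) w) \<le> (\<rho> + \<delta>) * norm z * norm w"
          using c0[of l] by simp
      qed (use \<open>0 \<le> \<rho>\<close> \<delta> in simp)
    qed
    define B where "B = BB (E l Q)"
    have Bc: "\<And>a. continuous_on {0..1} (B a)" and Bcb: "\<And>a t. t \<in> {0..1} \<Longrightarrow> is_cbounded_op (B a t)"
      and BI: "\<And>t z w. t \<in> {0..1} \<Longrightarrow> (\<Sum>a<m. cinner (B a t z) (B a t w)) = cinner z w"
      and BE: "\<And>t z w. t \<in> {0..1} \<Longrightarrow> cmod ((\<Sum>a<m. \<mu> a * cinner (B a t z) (B a t w)) - cinner (E l Q t z) w) \<le> \<epsilon> * norm z * norm w"
      and BA: "\<And>a t. t \<in> {0..1} \<Longrightarrow> B a t \<noteq> 0 \<Longrightarrow> norm (A t - A (\<tau> a)) \<le> \<epsilon>"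
      using BB[OF \<open>adm (E l Q)\<close>] unfolding good_def B_def by auto
    have X: "X l Q t = (\<Sum>a<m. U (l * m + a) o\<^sub>L B a t)" for t by (simp add: X_def B_def)
    have Xz: "X l Q t z = (\<Sum>a<m. U (l * m + a) (B a t z))" for t z by (simp add: X blinfun.sum_left)
    have XX: "cinner (X l Q t z) (X l Q t w) = cinner z w" if t: "t \<in> {0..1}" for t z w
      using BI[OF t, of z w] by (simp add: Xz cinner_sum_left cinner_sum_right UU)
    have nX: "norm (X l Q t z) = norm z" if t: "t \<in> {0..1}" for t z
      by (rule norm_eq_of_cinner) (rule XX[OF t])
    have nB: "norm (B a t z) \<le> norm z" if "t \<in> {0..1}" "a < m" for a t z
    proof -
      have "complex_of_real (\<Sum>a<m. (norm (B a t z))\<^sup>2) = of_real ((norm z)\<^sup>2)"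
        using BI[OF that(1), of z z] by (simp add: cinner_self)
      then have "(\<Sum>a<m. (norm (B a t z))\<^sup>2) = (norm z)\<^sup>2" using of_real_eq_iff by blast
      moreover have "(norm (B a t z))\<^sup>2 \<le> (\<Sum>a<m. (norm (B a t z))\<^sup>2)"
        using that by (intro member_le_sum) auto
      ultimately show ?thesis by simp
    qed
    have QX: "cinner (Q t z) (X l Q t w) = 0" "cinner (X l Q t w) (Q t z) = 0" if t: "t \<in> {0..1}" for t z w
    proof -
      show "cinner (Q t z) (X l Q t w) = 0" using QU[OF t] by (simp add: Xz cinner_sum_right)
      then show "cinner (X l Q t w) (Q t z) = 0" by (rule cinner_commute_zero)
    qed
    define k where "k = (\<Sum>a<m. (1/4::real) ^ (l * m + a))"
    have K_Suc: "K (Suc l) = K l + k"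
    proof -
      have "(\<Sum>y<l * m + n. (1/4::real)^y) = K l + (\<Sum>a<n. (1/4) ^ (l * m + a))" for n
        by (induction n) (auto simp: K_def)
      from this[of m] show ?thesis by (simp add: K_def k_def add.commute)
    qed
    have k0: "k \<ge> 0" by (auto simp: k_def intro: sum_nonneg)
    have kle: "k \<le> 4/3 * (1/4)^l"
    proof -
      \<comment> \<open>Positivity of \<open>m\<close> enters here: it makes \<open>l * m\<close> at
        least \<open>l\<close>.\<close>
      have "k = (1/4)^(l * m) * (\<Sum>a<m. (1/4)^a)" by (simp add: k_def power_add sum_distrib_left)
      also have "\<dots> \<le> (1/4)^l * (4/3)"
        using m by (intro mult_mono sum_quarter_powers_le power_decreasing) (auto intro: sum_nonneg)
      finally show ?thesis by simp
    qed
    have "continuous_on {0..1} (\<lambda>t. Q t + c l *\<^sub>R X l Q t)"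
      unfolding X by (intro continuous_on_add continuous_on_scaleR continuous_on_const continuous_on_sum
          continuous_on_blinfun_compose Qc Bc)
    moreover have "is_cbounded_op (Q t + c l *\<^sub>R X l Q t)" if t: "t \<in> {0..1}" for t
      unfolding X by (intro is_cbounded_op_add is_cbounded_op_scaleR is_cbounded_op_sum is_cbounded_op_compose Qcb Ucb Bcb t)
    moreover have "cinner ((Q t + c l *\<^sub>R X l Q t) z) ((Q t + c l *\<^sub>R X l Q t) w) = of_real (s (Suc l)) * cinner z w"
      if t: "t \<in> {0..1}" for t z w
      by (simp add: blinfun.add_left blinfun.scaleR_left cinner_add_left cinner_add_right cinner_scaleR_left
          cinner_scaleR_right QQ[OF t] QX[OF t] XX[OF t] s_Suc scaleR_conv_of_real power2_eq_square algebra_simps)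
    moreover have "cinner ((Q t + c l *\<^sub>R X l Q t) z) (U y w) = 0" if t: "t \<in> {0..1}" and y: "y \<ge> Suc l * m" for t y z w
    proof -
      have "cinner (U (l * m + a) x) (U y w) = 0" if "a < m" for a x
        using y that by (simp add: UU)
      then show ?thesis using QU[OF t, of y z w] y
        by (simp add: blinfun.add_left blinfun.scaleR_left cinner_add_left cinner_scaleR_left Xz cinner_sum_left)
    qed
    moreover have "cmod (cinner (A t ((Q t + c l *\<^sub>R X l Q t) z)) (U y w)) \<le> \<eta> * K (Suc l) * (1/4)^y * norm z * norm w \<and>
        cmod (cinner (A t (U y z)) ((Q t + c l *\<^sub>R X l Q t) w)) \<le> \<eta> * K (Suc l) * (1/4)^y * norm z * norm w"
      if t: "t \<in> {0..1}" and y: "y \<ge> Suc l * m" for t y z w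
    proof
      have ne: "l * m + a \<noteq> y" if "a < m" for a using y that by simp
      have 1: "cmod (cinner (A t (X l Q t z)) (U y w)) \<le> \<eta> * k * (1/4)^y * norm z * norm w"
      proof -
        have "cmod (cinner (A t (X l Q t z)) (U y w)) \<le> (\<Sum>a<m. \<eta> * (1/4)^(l * m + a) * (1/4)^y * norm z * norm w)"
          unfolding Xz blinfun.sum_right cinner_sum_left
        proof (intro order_trans[OF norm_sum] sum_mono)
          fix a assume "a \<in> {..<m}"
          then show "cmod (cinner (A t (U (l * m + a) (B a t z))) (U y w)) \<le> \<eta> * (1/4)^(l * m + a) * (1/4)^y * norm z * norm w"
            using \<eta> by (intro order_trans[OF Uoff[OF t ne]] mult_right_mono mult_left_mono nB t) auto
        qed
        then show ?thesis by (simp add: k_def sum_distrib_left sum_distrib_right)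
      qed
      have 2: "cmod (cinner (A t (U y z)) (X l Q t w)) \<le> \<eta> * k * (1/4)^y * norm z * norm w"
      proof -
        have "cmod (cinner (A t (U y z)) (X l Q t w)) \<le> (\<Sum>a<m. \<eta> * (1/4)^y * (1/4)^(l * m + a) * norm z * norm w)"
          unfolding Xz cinner_sum_right
        proof (intro order_trans[OF norm_sum] sum_mono)
          fix a assume "a \<in> {..<m}"
          then show "cmod (cinner (A t (U y z)) (U (l * m + a) (B a t w))) \<le> \<eta> * (1/4)^y * (1/4)^(l * m + a) * norm z * norm w"
            using \<eta> by (intro order_trans[OF Uoff[OF t ne[symmetric]]] mult_left_mono nB t) auto
        qed
        then show ?thesis by (simp add: k_def sum_distrib_left sum_distrib_right mult_ac)
      qed
      have cx: "c l * x \<le> x" if "x \<ge> 0" for x using that c1 c0[of l] by (simp add: mult_left_le_one_le)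
      have "cmod (cinner (A t ((Q t + c l *\<^sub>R X l Q t) z)) (U y w))
        \<le> \<eta> * K l * (1/4)^y * norm z * norm w + \<eta> * k * (1/4)^y * norm z * norm w"
        unfolding blinfun.add_left blinfun.scaleR_left blinfun.add_right blinfun.scaleR_right cinner_add_left cinner_scaleR_left
        using 1 y AQU[OF t, of y z w] cx[of "cmod (cinner (A t (X l Q t z)) (U y w))"] c0[of l]
        by (intro norm_triangle_le add_mono) auto
      then show "cmod (cinner (A t ((Q t + c l *\<^sub>R X l Q t) z)) (U y w)) \<le> \<eta> * K (Suc l) * (1/4)^y * norm z * norm w"
        by (simp add: K_Suc algebra_simps)
      have "cmod (cinner (A t (U y z)) ((Q t + c l *\<^sub>R X l Q t) w))
        \<le> \<eta> * K l * (1/4)^y * norm z * norm w + \<eta> * k * (1/4)^y * norm z * norm w"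
        unfolding blinfun.add_left blinfun.scaleR_left cinner_add_right cinner_scaleR_right
        using 2 y AUQ[OF t, of y z w] cx[of "cmod (cinner (A t (U y z)) (X l Q t w))"] c0[of l]
        by (intro norm_triangle_le add_mono) auto
      then show "cmod (cinner (A t (U y z)) ((Q t + c l *\<^sub>R X l Q t) w)) \<le> \<eta> * K (Suc l) * (1/4)^y * norm z * norm w"
        by (simp add: K_Suc algebra_simps)
    qed
    moreover have "cmod (of_real (s (Suc l)) * cinner (D t z) w -
        cinner (A t ((Q t + c l *\<^sub>R X l Q t) z)) ((Q t + c l *\<^sub>R X l Q t) w)) \<le> (c (Suc l))\<^sup>2 * \<delta> * norm z * norm w"
      if t: "t \<in> {0..1}" for t z w
    proof -
      define n where "n = norm z * norm w"
      have n0: "n \<ge> 0" by (simp add: n_def)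
      \<comment> \<open>The cross terms carry only one factor \<open>c l\<close>, which is estimated
        by 1; their smallness comes from \<open>k\<close> instead. Numerically, 16/9 times
        \<open>(1/4)^l\<close> is below \<open>3 * (c l)\<^sup>2\<close>, which is 9/4 times
        \<open>(1/4)^l\<close>.\<close>
      have kb: "\<eta> * K l * k * n \<le> 3 * \<eta> * (c l)\<^sup>2 * n"
      proof -
        have "K l * k \<le> 4/3 * (4/3 * (1/4)^l)" using K0[of l] k0 K43[of l] kle by (intro mult_mono) auto
        also have "\<dots> \<le> 3 * (c l)\<^sup>2" by (simp add: c2)
        finally have "\<eta> * n * (K l * k) \<le> \<eta> * n * (3 * (c l)\<^sup>2)" using \<eta> n0 by (intro mult_left_mono) auto
        then show ?thesis by (simp add: mult_ac)
      qed
      have 1: "cmod (cinner (A t (Q t z)) (X l Q t w)) \<le> \<eta> * K l * k * n"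
      proof -
        have "cmod (cinner (A t (Q t z)) (X l Q t w)) \<le> (\<Sum>a<m. \<eta> * K l * (1/4)^(l * m + a) * norm z * norm w)"
          unfolding Xz cinner_sum_right
        proof (intro order_trans[OF norm_sum] sum_mono)
          fix a assume "a \<in> {..<m}"
          then show "cmod (cinner (A t (Q t z)) (U (l * m + a) (B a t w))) \<le> \<eta> * K l * (1/4)^(l * m + a) * norm z * norm w"
            using \<eta> K0 by (intro order_trans[OF AQU[OF t]] mult_left_mono nB t) auto
        qed
        then show ?thesis by (simp add: k_def n_def sum_distrib_left sum_distrib_right mult_ac)
      qed
      have 2: "cmod (cinner (A t (X l Q t z)) (Q t w)) \<le> \<eta> * K l * k * n"
      proof -
        have "cmod (cinner (A t (X l Q t z)) (Q t w)) \<le> (\<Sum>a<m. \<eta> * K l * (1/4)^(l * m + a) * norm z * norm w)"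
          unfolding Xz blinfun.sum_right cinner_sum_left
        proof (intro order_trans[OF norm_sum] sum_mono)
          fix a assume "a \<in> {..<m}"
          then show "cmod (cinner (A t (U (l * m + a) (B a t z))) (Q t w)) \<le> \<eta> * K l * (1/4)^(l * m + a) * norm z * norm w"
            using \<eta> K0 by (intro order_trans[OF AUQ[OF t]] mult_right_mono mult_left_mono nB t) auto
        qed
        then show ?thesis by (simp add: k_def n_def sum_distrib_left sum_distrib_right mult_ac)
      qed
      have 3: "cmod (cinner (A t (X l Q t z)) (X l Q t w) - cinner (E l Q t z) w) \<le> (3 * \<eta> + 2 * \<epsilon>) * n"
      proof -
        have "cmod (cinner (A t (X l Q t z)) (X l Q t w) - (\<Sum>a<m. \<mu> a * cinner (B a t z) (B a t w)))
          \<le> (2 * \<eta> + (\<epsilon> + \<eta>)) * norm z * norm w"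
          unfolding X
        proof (rule compression_estimate)
          show "(\<Sum>a<m. cinner (B a t z) (B a t w)) = cinner z w" for z w by (rule BI[OF t])
          show "cmod (cinner (A t (U (l * m + a) z)) (U (l * m + b) w)) \<le> \<eta> * (1/4)^a * (1/4)^b * norm z * norm w"
            if "a \<noteq> b" for a b z w
          proof -
            have "cmod (cinner (A t (U (l * m + a) z)) (U (l * m + b) w))
                \<le> \<eta> * (1/4)^(l * m + a) * (1/4)^(l * m + b) * norm z * norm w"
              using that by (intro Uoff t) simp
            also have "\<dots> \<le> \<eta> * (1/4)^a * (1/4)^b * norm z * norm w"
              using \<eta> by (intro mult_mono power_decreasing) auto
            finally show ?thesis .
          qed
          \<comment> \<open>Localisation is used here: where \<open>B a t\<close> is nonzero,
            \<open>A t\<close> is within \<open>\<epsilon>\<close> of \<open>A (\<tau> a)\<close>,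
            and there the isometry compresses to almost \<open>\<mu> a\<close>, because
            \<open>l * m + a\<close> is congruent to \<open>a\<close> modulo
            \<open>m\<close>.\<close>
          show "cmod (cinner (A t (U (l * m + a) z)) (U (l * m + a) w) - \<mu> a * cinner z w) \<le> (\<epsilon> + \<eta>) * norm z * norm w"
            if a: "a < m" "B a t \<noteq> 0" for a z w
          proof -
            define V where "V = U (l * m + a)"
            have nV: "norm (V x) = norm x" for x
              by (rule norm_eq_of_cinner) (simp add: V_def UU)
            have "cinner (A t (V z)) (V w) - \<mu> a * cinner z w
              = cinner ((A t - A (\<tau> a)) (V z)) (V w) + (cinner (A (\<tau> a) (V z)) (V w) - \<mu> a * cinner z w)"
              by (simp add: blinfun.diff_left cinner_diff_left)
            also have "cmod \<dots> \<le> \<epsilon> * norm z * norm w + \<eta> * norm z * norm w"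
            proof (intro norm_triangle_le add_mono)
              have "cmod (cinner ((A t - A (\<tau> a)) (V z)) (V w)) \<le> norm ((A t - A (\<tau> a)) (V z)) * norm (V w)"
                by (rule cinner_Cauchy_Schwarz)
              also have "\<dots> \<le> (norm (A t - A (\<tau> a)) * norm (V z)) * norm (V w)"
                by (intro mult_right_mono norm_blinfun) simp
              also have "\<dots> \<le> \<epsilon> * norm z * norm w"
                unfolding nV using BA[OF t a(2)] by (intro mult_right_mono) auto
              finally show "cmod (cinner ((A t - A (\<tau> a)) (V z)) (V w)) \<le> \<epsilon> * norm z * norm w" .
              show "cmod (cinner (A (\<tau> a) (V z)) (V w) - \<mu> a * cinner z w) \<le> \<eta> * norm z * norm w"
                using Udiag[of "l * m + a" z w] a(1) by (simp add: V_def)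
            qed
            finally show ?thesis unfolding V_def by (simp add: algebra_simps)
          qed
        qed (use \<eta> \<epsilon> in auto)
        with BE[OF t, of z w] have "cmod (cinner (A t (X l Q t z)) (X l Q t w) - (\<Sum>a<m. \<mu> a * cinner (B a t z) (B a t w)))
          + cmod ((\<Sum>a<m. \<mu> a * cinner (B a t z) (B a t w)) - cinner (E l Q t z) w)
          \<le> (3 * \<eta> + 2 * \<epsilon>) * n" by (simp add: n_def algebra_simps)
        then show ?thesis
          unfolding dist_norm[symmetric] by (rule order_trans[OF dist_triangle])
      qed
      \<comment> \<open>The corrected target is designed to cancel the old residual in this
        expansion. What remains is the error of the new term and the two cross terms.\<close>
      have "of_real (s (Suc l)) * cinner (D t z) w -
          cinner (A t ((Q t + c l *\<^sub>R X l Q t) z)) ((Q t + c l *\<^sub>R X l Q t) w)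
        = - (of_real ((c l)\<^sup>2) * (cinner (A t (X l Q t z)) (X l Q t w) - cinner (E l Q t z) w))
          - of_real (c l) * cinner (A t (Q t z)) (X l Q t w) - of_real (c l) * cinner (A t (X l Q t z)) (Q t w)"
        unfolding right_diff_distrib cE[OF t]
        by (simp add: blinfun.add_left blinfun.scaleR_left blinfun.add_right blinfun.scaleR_right
            cinner_add_left cinner_add_right cinner_scaleR_left cinner_scaleR_right scaleR_conv_of_real
            power2_eq_square algebra_simps)
      also have "cmod \<dots> \<le> (c l)\<^sup>2 * ((3 * \<eta> + 2 * \<epsilon>) * n) + \<eta> * K l * k * n + \<eta> * K l * k * n"
      proof -
        have cx: "cmod (of_real (c l) * x) \<le> cmod x" for x
          using c1[of l] c0[of l] by (simp add: norm_mult mult_left_le_one_le)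
        have "cmod (of_real ((c l)\<^sup>2) * (cinner (A t (X l Q t z)) (X l Q t w) - cinner (E l Q t z) w))
            \<le> (c l)\<^sup>2 * ((3 * \<eta> + 2 * \<epsilon>) * n)"
          using 3 unfolding norm_mult norm_of_real by (simp add: mult_left_mono)
        then show ?thesis
          using order_trans[OF cx 1] order_trans[OF cx 2]
          by (intro order_trans[OF norm_triangle_ineq4] add_mono) (simp_all only: norm_minus_cancel)
      qed
      also have "\<dots> \<le> (c l)\<^sup>2 * ((3 * \<eta> + 2 * \<epsilon>) * n) + 3 * \<eta> * (c l)\<^sup>2 * n + 3 * \<eta> * (c l)\<^sup>2 * n"
        using kb by linarith
      also have "\<dots> = (c l)\<^sup>2 * n * (9 * \<eta> + 2 * \<epsilon>)" by (simp add: algebra_simps)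
      also have "\<dots> \<le> (c l)\<^sup>2 * n * (\<delta> / 4)"
        using n0 \<delta> by (intro mult_left_mono) (auto simp: \<eta>_def \<epsilon>_def)
      also have "\<dots> = (c (Suc l))\<^sup>2 * \<delta> * norm z * norm w" by (simp add: c_Suc n_def)
      finally show ?thesis .
    qed
    moreover have "norm (X l Q t) \<le> 1" if "t \<in> {0..1}" for t
      using nX[OF that] by (intro norm_blinfun_bound) auto
    ultimately show ?thesis unfolding Inv_def by blast
  qed
  define P where "P = rec_nat (\<lambda>t. 0) (\<lambda>l Q t. Q t + c l *\<^sub>R X l Q t)"
  have P0: "P 0 = (\<lambda>t. 0)" and PS: "P (Suc l) = (\<lambda>t. P l t + c l *\<^sub>R X l (P l) t)" for l
    by (simp_all add: P_def)
  have inv: "Inv l (P l)" for l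
  proof (induction l)
    case 0
    show ?case using K0[of 0] \<eta> \<delta> by (simp add: Inv_def P0 s_def is_cbounded_op_0)
  next
    case (Suc l)
    show ?case unfolding PS using step[OF Suc] by blast
  qed
  \<comment> \<open>The increments are bounded by \<open>c l\<close>, hence by
    \<open>(1/2)^l\<close>, uniformly in time. The geometric tail gives uniform convergence and so
    continuity of the limit.\<close>
  have nP: "norm (P (l + j) t - P l t) \<le> 2 * (1/2)^l - 2 * (1/2)^(l + j)" if t: "t \<in> {0..1}" for l j t
  proof (induction j)
    case (Suc j)
    have "norm (c (l + j) *\<^sub>R X (l + j) (P (l + j)) t) \<le> (1/2)^(l + j)"
      using step[OF inv[of "l + j"]] t c0[of "l + j"] cle[of "l + j"]
      by (auto intro!: mult_left_le[THEN order_trans])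
    moreover have "P (l + Suc j) t - P l t = (P (l + j) t - P l t) + c (l + j) *\<^sub>R X (l + j) (P (l + j)) t"
      by (simp add: PS)
    ultimately have "norm (P (l + Suc j) t - P l t) \<le> (2 * (1/2)^l - 2 * (1/2)^(l + j)) + (1/2)^(l + j)"
      using Suc norm_triangle_mono by metis
    then show ?case by simp
  qed simp
  have "uniformly_Cauchy_on {0..1} P"
  proof (rule uniformly_Cauchy_onI')
    fix e :: real assume "e > 0"
    then obtain M where M: "(1/2::real)^M < e / 2" using real_arch_pow_inv[of "e / 2" "1/2"] by auto
    have "dist (P l t) (P n t) < e" if tl: "t \<in> {0..1}" "l \<ge> M" "n > l" for t l n
    proof -
      obtain j where j: "n = l + j" using tl(3) less_imp_add_positive by blast
      have "dist (P l t) (P n t) \<le> 2 * (1/2)^l - 2 * (1/2)^(l + j)"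
        using nP[OF tl(1), of l j] by (simp add: j dist_norm norm_minus_commute)
      also have "\<dots> \<le> 2 * (1/2)^l" by simp
      also have "\<dots> \<le> 2 * (1/2)^M" using tl(2) by (intro mult_left_mono power_decreasing) auto
      also have "\<dots> < e" using M by simp
      finally show ?thesis .
    qed
    then show "\<exists>M. \<forall>t\<in>{0..1}. \<forall>l\<ge>M. \<forall>n>l. dist (P l t) (P n t) < e" by blast
  qed
  then have "uniformly_convergent_on {0..1} P" by (simp add: uniformly_convergent_eq_Cauchy)
  then obtain S where S: "uniform_limit {0..1} P S sequentially"
    unfolding uniformly_convergent_on_def by blast
  have Slim: "(\<lambda>l. P l t) \<longlonglongrightarrow> S t" if "t \<in> {0..1}" for t
    using tendsto_uniform_limitI[OF S that] .
  have Szlim: "(\<lambda>l. P l t z) \<longlonglongrightarrow> S t z" if "t \<in> {0..1}" for t z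
    using bounded_linear.tendsto[OF blinfun.bounded_linear_left Slim[OF that]] .
  have q0: "(\<lambda>l. (1/4::real)^l) \<longlonglongrightarrow> 0" by (rule LIMSEQ_realpow_zero) auto
  have slim: "s \<longlonglongrightarrow> 1"
    unfolding s_def[abs_def] using tendsto_diff[OF tendsto_const[of 1] q0] by simp
  have "continuous_on {0..1} S"
    using inv by (intro uniform_limit_theorem[OF _ S]) (auto simp: Inv_def)
  moreover have "is_cbounded_op (S t)" if t: "t \<in> {0..1}" for t
    using inv t by (intro is_cbounded_op_LIMSEQ[OF _ Slim[OF t]]) (auto simp: Inv_def)
  moreover have "cinner (S t z) (S t w) = cinner z w" if t: "t \<in> {0..1}" for t z w
  proof (rule LIMSEQ_unique)
    show "(\<lambda>l. cinner (P l t z) (P l t w)) \<longlonglongrightarrow> cinner (S t z) (S t w)"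
      by (intro tendsto_cinner Szlim t)
    have "cinner (P l t z) (P l t w) = of_real (s l) * cinner z w" for l
      using inv[of l] t unfolding Inv_def by blast
    then show "(\<lambda>l. cinner (P l t z) (P l t w)) \<longlonglongrightarrow> cinner z w"
      using tendsto_mult[OF tendsto_of_real[OF slim] tendsto_const[of "cinner z w"]] by simp
  qed
  moreover have "cinner (A t (S t z)) (S t w) = cinner (D t z) w" if t: "t \<in> {0..1}" for t z w
  proof -
    have lim: "(\<lambda>l. of_real (s l) * cinner (D t z) w - cinner (A t (P l t z)) (P l t w))
        \<longlonglongrightarrow> of_real 1 * cinner (D t z) w - cinner (A t (S t z)) (S t w)"
      by (intro tendsto_diff tendsto_mult tendsto_of_real slim tendsto_const tendsto_cinner Szlim t
          bounded_linear.tendsto[OF blinfun.bounded_linear_right])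
    have "(\<lambda>l. of_real (s l) * cinner (D t z) w - cinner (A t (P l t z)) (P l t w)) \<longlonglongrightarrow> 0"
    proof (rule Lim_null_comparison)
      show "\<forall>\<^sub>F l in sequentially. cmod (of_real (s l) * cinner (D t z) w - cinner (A t (P l t z)) (P l t w))
          \<le> 3/4 * (1/4)^l * (\<delta> * norm z * norm w)"
      proof (intro always_eventually allI)
        fix l
        have "cmod (of_real (s l) * cinner (D t z) w - cinner (A t (P l t z)) (P l t w)) \<le> (c l)\<^sup>2 * \<delta> * norm z * norm w"
          using inv[of l] t unfolding Inv_def by blast
        then show "cmod (of_real (s l) * cinner (D t z) w - cinner (A t (P l t z)) (P l t w))
          \<le> 3/4 * (1/4)^l * (\<delta> * norm z * norm w)" by (simp add: c2 mult.assoc)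
      qed
      have "(\<lambda>l. 3/4 * (1/4)^l * (\<delta> * norm z * norm w)) \<longlonglongrightarrow> 3/4 * 0 * (\<delta> * norm z * norm w)"
        by (intro tendsto_mult tendsto_const q0)
      then show "(\<lambda>l. 3/4 * (1/4)^l * (\<delta> * norm z * norm w)) \<longlonglongrightarrow> 0" by simp
    qed
    from LIMSEQ_unique[OF lim this] show ?thesis by simp
  qed
  ultimately show ?thesis by (intro exI[of _ S]) blast
qed

section \<open>From the distance to the boundary to a common disc\<close>

lemma mem_of_norm_less_infdist_frontier:
  fixes W :: "'a::real_normed_vector set"
  assumes "0 \<in> W" "norm x < infdist 0 (frontier W)"
  shows "x \<in> W"
proof (rule ccontr)
  assume "x \<notin> W"
  \<comment> \<open>The ball of radius \<open>R\<close> around 0 is connected, so a point of it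
    outside \<open>W\<close> would force a frontier point closer to 0 than \<open>R\<close>. If the
    frontier is empty, \<open>infdist\<close> is 0 and no \<open>x\<close> satisfies the
    hypothesis.\<close>
  define R where "R = infdist 0 (frontier W)"
  have "0 \<in> ball 0 R \<inter> W" "x \<in> ball 0 R - W"
    using assms \<open>x \<notin> W\<close> le_less_trans[OF norm_ge_zero assms(2)] by (auto simp: R_def)
  then have "ball 0 R \<inter> frontier W \<noteq> {}"
    by (intro connected_Int_frontier connected_ball) blast+
  then obtain y where "y \<in> frontier W" "norm y < R" by auto
  then show False using infdist_le[of y "frontier W" 0] by (simp add: R_def)
qed

theorem theorem1p2:
  fixes A :: "real \<Rightarrow> ('h::{complex_inner, complete_space} \<Rightarrow>\<^sub>L 'h)"
    and D :: "real \<Rightarrow> ('z::{complex_inner, complete_space} \<Rightarrow>\<^sub>L 'z)"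
  assumes "separable_space (euclidean :: 'h topology)"
    and "infinite_dimensional TYPE('h)"
    and "\<forall>t\<in>{0..1}. is_cbounded_op (A t)"
    and "continuous_on {0..1} A"
    and "\<forall>t\<in>{0..1}. 0 \<in> interior (ess_num_range (A t))"
    and "separable_space (euclidean :: 'z topology)"
    and "\<forall>t\<in>{0..1}. is_cbounded_op (D t)"
    and "continuous_on {0..1} D"
    and "(SUP t\<in>{0..1}. norm (D t)) < (INF t\<in>{0..1}. infdist 0 (frontier (ess_num_range (A t))))"
  shows "\<exists>S :: real \<Rightarrow> ('z \<Rightarrow>\<^sub>L 'h). continuous_on {0..1} S \<and>
    (\<forall>t\<in>{0..1}. is_cbounded_op (S t) \<and>
       (\<forall>z. norm (blinfun_apply (S t) z) = norm z) \<and>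
       (\<forall>z w. cinner (blinfun_apply (A t) (blinfun_apply (S t) z)) (blinfun_apply (S t) w)
              = cinner (blinfun_apply (D t) z) w))"
proof -
  define \<rho> where "\<rho> = (SUP t\<in>{0..1}. norm (D t))"
  define r where "r = (INF t\<in>{0..1}. infdist 0 (frontier (ess_num_range (A t))))"
  have "compact ((\<lambda>t. norm (D t)) ` {0..1})"
    using assms(8) by (intro compact_continuous_image continuous_on_norm) auto
  then have "bdd_above ((\<lambda>t. norm (D t)) ` {0..1})"
    by (intro bounded_imp_bdd_above compact_imp_bounded)
  then have \<rho>: "norm (D t) \<le> \<rho>" if "t \<in> {0..1}" for t
    unfolding \<rho>_def using that by (intro cSUP_upper)
  have bb: "bdd_below ((\<lambda>t. infdist 0 (frontier (ess_num_range (A t)))) ` {0..1})"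
    by (intro bdd_belowI[of _ 0]) (auto simp: infdist_nonneg)
  \<comment> \<open>The gap hypothesis enters through this inclusion: one open disc of radius
    \<open>r\<close> lies in the essential numerical ranges at all times.\<close>
  have W: "l \<in> ess_num_range (A t)" if t: "t \<in> {0..1}" and l: "cmod l < r" for t l
  proof (rule mem_of_norm_less_infdist_frontier)
    show "0 \<in> ess_num_range (A t)" using assms(5) t interior_subset by blast
    have "r \<le> infdist 0 (frontier (ess_num_range (A t)))"
      unfolding r_def using t by (intro cINF_lower bb)
    then show "cmod l < infdist 0 (frontier (ess_num_range (A t)))" using l by simp
  qed
  have "\<rho> < r" using assms(9) by (simp add: \<rho>_def r_def)
  have "\<exists>S :: real \<Rightarrow> 'z \<Rightarrow>\<^sub>L 'h. continuous_on {0..1} S \<and> (\<forall>t\<in>{0..1}. is_cbounded_op (S t) \<and>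
    (\<forall>z w. cinner (S t z) (S t w) = cinner z w) \<and>
    (\<forall>z w. cinner (A t (S t z)) (S t w) = cinner (D t z) w))"
    using assms(3,7) by (intro exists_exact_compression[OF assms(6,4) _ assms(8) _ \<rho> \<open>\<rho> < r\<close> W]) auto
  then obtain S :: "real \<Rightarrow> 'z \<Rightarrow>\<^sub>L 'h" where S: "continuous_on {0..1} S" "\<And>t. t \<in> {0..1} \<Longrightarrow> is_cbounded_op (S t)"
    "\<And>t z w. t \<in> {0..1} \<Longrightarrow> cinner (S t z) (S t w) = cinner z w"
    "\<And>t z w. t \<in> {0..1} \<Longrightarrow> cinner (A t (S t z)) (S t w) = cinner (D t z) w"
    by blast
  have "norm (S t z) = norm z" if "t \<in> {0..1}" for t z
    using S(3)[OF that] by (rule norm_eq_of_cinner)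
  then show ?thesis using S by (intro exI[of _ S]) blast
qed

end
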